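(* Let $u\in H^1(\mathbb{R})$ and let $Y=(y,U,H,q,w,h)\in\mathcal{G}$ be the Lagrangian element associated with $u$. For each integer $n\ge1$ let $\Delta\xi_n>0$ and a positive integer $N_n$ be such that, with $R_n=N_n\Delta\xi_n$, one has $\frac1n=\frac1{R_n}+\Delta\xi_n$. Then there exists a sequence $Y_n=(y_n,U_n,H_n,q_n,w_n,h_n)\in F_{\{\Delta\xi_n,R_n\}}$ such that $$\lim_{n\to\infty}\|Y_n-Y\|_F=0$$ and $$q_nh_n\ge U_n^2q_n^2+w_n^2,\qquad q_n+h_n=1,\qquad\text{for all } n \text{ and for all }\xi .$$ Moreover, if $Y\in F^e$, then $\|Y_n\|_{F^e}\le C\|Y\|_{F^e}$, and if $Y\in F^\alpha$ (for a given $\alpha>1$), then $\|Y_n\|_{F^\alpha}\le C\|Y\|_{F^\alpha}$, where the constant $C$ does not depend on $Y$ and $n$.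
   Context: All function spaces are over $\mathbb{R}$. $F=L^\infty\times(L^\infty\cap L^2)\times L^\infty\times L^2\times L^2\times L^2$ is the Banach space of elements $Y=(\zeta,U,H,v,w,h)$ with norm $\|Y\|_F=\|\zeta\|_{L^\infty}+\|U\|_{L^2}+\|U\|_{L^\infty}+\|H\|_{L^\infty}+\|v\|_{L^2}+\|w\|_{L^2}+\|h\|_{L^2}$. One writes $y(\xi)=\xi+\zeta(\xi)$, $q=1+v$, and also $Y=(y,U,H,q,w,h)$ for the same element. $\mathcal{G}$ is the set of $Y\in F$ such that: $q,w,h\in L^\infty$; $qh=U^2q^2+w^2$, $q\ge0$, $h\ge0$ and $q+h\ge c$ almost everywhere for some constant $c>0$; and $y,U,H$ are (weakly) differentiable with $y_\xi=q$, $U_\xi=w$, $H_\xi=h$. Lagrangian element associated with $u\in H^1(\mathbb{R})$: $y$ is defined by $y(\xi)+\int_{-\infty}^{y(\xi)}(u^2+u_x^2)\,dx=\xi$, and $U=u\circ y$, $H(\xi)=\xi-y(\xi)$, $q=y_\xi$, $w=U_\xi$, $h=H_\xi$. In particular $q+h=1$ and $qh=q^2U^2+w^2$ a.e. $F^e=\{Y\in F: q,w,h\in L^\infty,\ e^{|\xi|/2}U\in L^2,\ e^{|\xi|/2}w\in L^2,\ e^{|\xi|}h\in L^1\}$ with norm $\|Y\|_{F^e}=\|Y\|_F+\|q\|_{L^\infty}+\|w\|_{L^\infty}+\|h\|_{L^\infty}+\|e^{|\xi|/2}U\|_{L^2}+\|e^{|\xi|/2}w\|_{L^2}+\|e^{|\xi|}h\|_{L^1}$.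 For $\alpha>1$, $F^\alpha$ is defined in the same way with $e^{|\xi|/2}$ replaced by $(1+|\xi|)^{\alpha/2}$ and $e^{|\xi|}$ replaced by $(1+|\xi|)^\alpha$, with the corresponding norm. For $\Delta\xi>0$, $N\in\mathbb{N}$, $R=N\Delta\xi$ and $\xi_i=i\Delta\xi$ ($i\in\mathbb{Z}$), $F_{\{\Delta\xi,R\}}$ is the set of $Y=(\zeta,U,H,v,w,h)\in F$ all of whose components are constant on each interval $[\xi_i,\xi_{i+1})$ and such that $U=v=w=h=0$ on $(-\infty,-R)\cup[R,\infty)$, $\zeta$ and $H$ are constant on $[R,\infty)$, $\zeta$ is constant on $(-\infty,-R)$, and $H=0$ on $(-\infty,-R)$. *)

theory Defs
  imports "HOL-Analysis.Analysis" "HOL-Probability.Essential_Supremum"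
begin

section \<open>Lebesgue and Sobolev spaces on the real line\<close>

text \<open>Classes of functions modulo null sets are handled through their representatives: membership
  in a space and the value of a norm depend only on the class.\<close>

definition in_L1 :: "(real \<Rightarrow> real) \<Rightarrow> bool" where
  "in_L1 f \<longleftrightarrow> integrable lebesgue f"

definition norm_L1 :: "(real \<Rightarrow> real) \<Rightarrow> real" where
  "norm_L1 f = (LINT x|lebesgue. \<bar>f x\<bar>)"

definition in_L2 :: "(real \<Rightarrow> real) \<Rightarrow> bool" where
  "in_L2 f \<longleftrightarrow> f \<in> borel_measurable lebesgue \<and> integrable lebesgue (\<lambda>x. (f x)\<^sup>2)"

definition norm_L2 :: "(real \<Rightarrow> real) \<Rightarrow> real" where
  "norm_L2 f = sqrt (LINT x|lebesgue. (f x)\<^sup>2)"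

definition in_Linf :: "(real \<Rightarrow> real) \<Rightarrow> bool" where
  "in_Linf f \<longleftrightarrow> f \<in> borel_measurable lebesgue \<and> esssup lebesgue (\<lambda>x. ereal \<bar>f x\<bar>) < \<infinity>"

definition norm_Linf :: "(real \<Rightarrow> real) \<Rightarrow> real" where
  "norm_Linf f = real_of_ereal (esssup lebesgue (\<lambda>x. ereal \<bar>f x\<bar>))"

definition locally_integrable :: "(real \<Rightarrow> real) \<Rightarrow> bool" where
  "locally_integrable f \<longleftrightarrow> (\<forall>a b. set_integrable lebesgue {a..b} f)"

text \<open>Weak derivatives are tested, as in Brezis' treatment of Sobolev spaces in one dimension, against
  compactly supported \<open>C\<^sup>1\<close> functions; here \<open>\<phi>'\<close> is the classical derivative of \<open>\<phi>\<close>.\<close>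

definition weak_deriv :: "(real \<Rightarrow> real) \<Rightarrow> (real \<Rightarrow> real) \<Rightarrow> bool" where
  "weak_deriv f g \<longleftrightarrow> locally_integrable f \<and> locally_integrable g \<and>
     (\<forall>\<phi> \<phi>'. (\<forall>x. (\<phi> has_real_derivative \<phi>' x) (at x)) \<and> continuous_on UNIV \<phi>' \<and>
        (\<exists>r. \<forall>x. \<bar>x\<bar> > r \<longrightarrow> \<phi> x = 0) \<longrightarrow>
        (LINT x|lebesgue. f x * \<phi>' x) = - (LINT x|lebesgue. g x * \<phi> x))"

definition in_H1 :: "(real \<Rightarrow> real) \<Rightarrow> bool" where
  "in_H1 u \<longleftrightarrow> in_L2 u \<and> (\<exists>ux. in_L2 ux \<and> weak_deriv u ux)"

section \<open>Lagrangian variables\<close>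

text \<open>The components are \<open>(\<zeta>, U, H, v, w, h)\<close>; the variables \<open>y\<close> and \<open>q\<close> are derived from
  \<open>\<zeta>\<close> and \<open>v\<close>.\<close>

datatype lagr = Lagr
  (zetaL: "real \<Rightarrow> real") (UL: "real \<Rightarrow> real") (HL: "real \<Rightarrow> real")
  (vL: "real \<Rightarrow> real") (wL: "real \<Rightarrow> real") (hL: "real \<Rightarrow> real")

definition yL :: "lagr \<Rightarrow> real \<Rightarrow> real" where
  "yL Y \<xi> = \<xi> + zetaL Y \<xi>"

definition qL :: "lagr \<Rightarrow> real \<Rightarrow> real" where
  "qL Y \<xi> = 1 + vL Y \<xi>"

definition diffL :: "lagr \<Rightarrow> lagr \<Rightarrow> lagr" where
  "diffL X Y = Lagr (\<lambda>\<xi>. zetaL X \<xi> - zetaL Y \<xi>) (\<lambda>\<xi>. UL X \<xi> - UL Y \<xi>) (\<lambda>\<xi>. HL X \<xi> - HL Y \<xi>)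
     (\<lambda>\<xi>. vL X \<xi> - vL Y \<xi>) (\<lambda>\<xi>. wL X \<xi> - wL Y \<xi>) (\<lambda>\<xi>. hL X \<xi> - hL Y \<xi>)"

definition F_space :: "lagr set" where
  "F_space = {Y. in_Linf (zetaL Y) \<and> in_Linf (UL Y) \<and> in_L2 (UL Y) \<and> in_Linf (HL Y) \<and>
     in_L2 (vL Y) \<and> in_L2 (wL Y) \<and> in_L2 (hL Y)}"

definition norm_F :: "lagr \<Rightarrow> real" where
  "norm_F Y = norm_Linf (zetaL Y) + norm_L2 (UL Y) + norm_Linf (UL Y) + norm_Linf (HL Y)
     + norm_L2 (vL Y) + norm_L2 (wL Y) + norm_L2 (hL Y)"

definition G_set :: "lagr set" where
  "G_set = {Y \<in> F_space. in_Linf (qL Y) \<and> in_Linf (wL Y) \<and> in_Linf (hL Y) \<and>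
     (AE \<xi> in lebesgue. qL Y \<xi> * hL Y \<xi> = (UL Y \<xi>)\<^sup>2 * (qL Y \<xi>)\<^sup>2 + (wL Y \<xi>)\<^sup>2) \<and>
     (AE \<xi> in lebesgue. qL Y \<xi> \<ge> 0) \<and> (AE \<xi> in lebesgue. hL Y \<xi> \<ge> 0) \<and>
     (\<exists>c>0. AE \<xi> in lebesgue. qL Y \<xi> + hL Y \<xi> \<ge> c) \<and>
     weak_deriv (yL Y) (qL Y) \<and> weak_deriv (UL Y) (wL Y) \<and> weak_deriv (HL Y) (hL Y)}"

text \<open>Composition with \<open>y\<close> is only meaningful for the continuous representative of \<open>u\<close>, here \<open>ut\<close>.\<close>

definition lagr_of :: "(real \<Rightarrow> real) \<Rightarrow> lagr \<Rightarrow> bool" where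
  "lagr_of u Y \<longleftrightarrow>
     (\<exists>ut ux. continuous_on UNIV ut \<and> (AE x in lebesgue. ut x = u x) \<and> in_L2 ux \<and> weak_deriv u ux \<and>
        (\<forall>\<xi>. yL Y \<xi> + (LINT x:{..yL Y \<xi>}|lebesgue. (u x)\<^sup>2 + (ux x)\<^sup>2) = \<xi>) \<and>
        (\<forall>\<xi>. UL Y \<xi> = ut (yL Y \<xi>))) \<and>
     (\<forall>\<xi>. HL Y \<xi> = \<xi> - yL Y \<xi>) \<and>
     weak_deriv (yL Y) (qL Y) \<and> weak_deriv (UL Y) (wL Y) \<and> weak_deriv (HL Y) (hL Y)"

text \<open>Weighted spaces: \<open>r\<close> is the weight for the \<open>L\<^sup>2\<close> conditions and \<open>s\<close> the one for the
  \<open>L\<^sup>1\<close> condition.\<close>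

definition F_weighted :: "(real \<Rightarrow> real) \<Rightarrow> (real \<Rightarrow> real) \<Rightarrow> lagr set" where
  "F_weighted r s = {Y \<in> F_space. in_Linf (qL Y) \<and> in_Linf (wL Y) \<and> in_Linf (hL Y) \<and>
     in_L2 (\<lambda>\<xi>. r \<xi> * UL Y \<xi>) \<and> in_L2 (\<lambda>\<xi>. r \<xi> * wL Y \<xi>) \<and> in_L1 (\<lambda>\<xi>. s \<xi> * hL Y \<xi>)}"

definition norm_F_weighted :: "(real \<Rightarrow> real) \<Rightarrow> (real \<Rightarrow> real) \<Rightarrow> lagr \<Rightarrow> real" where
  "norm_F_weighted r s Y = norm_F Y + norm_Linf (qL Y) + norm_Linf (wL Y) + norm_Linf (hL Y)
     + norm_L2 (\<lambda>\<xi>. r \<xi> * UL Y \<xi>) + norm_L2 (\<lambda>\<xi>. r \<xi> * wL Y \<xi>) + norm_L1 (\<lambda>\<xi>. s \<xi> * hL Y \<xi>)"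

definition F_exp :: "lagr set" where
  "F_exp = F_weighted (\<lambda>\<xi>. exp (\<bar>\<xi>\<bar> / 2)) (\<lambda>\<xi>. exp \<bar>\<xi>\<bar>)"

definition norm_F_exp :: "lagr \<Rightarrow> real" where
  "norm_F_exp = norm_F_weighted (\<lambda>\<xi>. exp (\<bar>\<xi>\<bar> / 2)) (\<lambda>\<xi>. exp \<bar>\<xi>\<bar>)"

definition F_alpha :: "real \<Rightarrow> lagr set" where
  "F_alpha \<alpha> = F_weighted (\<lambda>\<xi>. (1 + \<bar>\<xi>\<bar>) powr (\<alpha> / 2)) (\<lambda>\<xi>. (1 + \<bar>\<xi>\<bar>) powr \<alpha>)"

definition norm_F_alpha :: "real \<Rightarrow> lagr \<Rightarrow> real" where
  "norm_F_alpha \<alpha> = norm_F_weighted (\<lambda>\<xi>. (1 + \<bar>\<xi>\<bar>) powr (\<alpha> / 2)) (\<lambda>\<xi>. (1 + \<bar>\<xi>\<bar>) powr \<alpha>)"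

definition grid_const :: "real \<Rightarrow> (real \<Rightarrow> real) \<Rightarrow> bool" where
  "grid_const d f \<longleftrightarrow> (\<forall>i::int. \<forall>\<xi>\<in>{of_int i * d ..< of_int (i + 1) * d}. f \<xi> = f (of_int i * d))"

definition F_grid :: "real \<Rightarrow> real \<Rightarrow> lagr set" where
  "F_grid d R = {Y \<in> F_space.
     grid_const d (zetaL Y) \<and> grid_const d (UL Y) \<and> grid_const d (HL Y) \<and>
     grid_const d (vL Y) \<and> grid_const d (wL Y) \<and> grid_const d (hL Y) \<and>
     (\<forall>\<xi>\<in>{..<-R} \<union> {R..}. UL Y \<xi> = 0 \<and> vL Y \<xi> = 0 \<and> wL Y \<xi> = 0 \<and> hL Y \<xi> = 0) \<and>
     (\<exists>a. \<forall>\<xi>\<in>{R..}. zetaL Y \<xi> = a) \<and> (\<exists>a. \<forall>\<xi>\<in>{R..}. HL Y \<xi> = a) \<and>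
     (\<exists>a. \<forall>\<xi>\<in>{..<-R}. zetaL Y \<xi> = a) \<and> (\<forall>\<xi>\<in>{..<-R}. HL Y \<xi> = 0)}"

end

theory Submission
  imports Defs
begin

text \<open>
The element \<open>Y\<close> of a function \<open>u\<close> satisfies \<open>q + h = 1\<close> and \<open>q h = U\<^sup>2 q\<^sup>2 + w\<^sup>2\<close> almost everywhere. To discretize
it, replace \<open>h\<close> and \<open>w\<close> by their means over the grid cells inside \<open>[-R, R)\<close> and by 0 elsewhere, put
\<open>q = 1 - h\<close>, sample \<open>H\<close> at the grid points, and let \<open>U\<close> take on each cell its value of least modulus.

The inequality \<open>q h \<ge> U\<^sup>2 q\<^sup>2 + w\<^sup>2\<close> for the discretization is a matter of convexity. If \<open>m\<close> is the least value of
\<open>U\<^sup>2\<close> on a cell, then \<open>w\<^sup>2 \<le> q (h - m q)\<close> there, which says that the quadratic polynomial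
\<open>t\<^sup>2 q + 2 t w + (h - m q)\<close> is nonnegative for every real \<open>t\<close>. These are linear conditions on \<open>(q, w, h)\<close> and
therefore hold for the means as well (\<open>cell_mean_inequality\<close>).

For the convergence, \<open>H\<close> and \<open>U\<close> are Lipschitz, and they have limits at both ends of the line: \<open>H\<close> because it is
monotone and bounded, \<open>U\<close> because it is Lipschitz and square integrable. So sampling converges
uniformly (\<open>H_uniform\<close>, \<open>U_uniform\<close>). The averages of \<open>h\<close> and \<open>w\<close> converge in \<open>L\<^sup>2\<close> because averaging is a
contraction of \<open>L\<^sup>2\<close> that converges on continuous functions of compact support (\<open>cell_avg_tendsto_L2\<close>).

The weighted bounds rest on two facts. The chosen values of \<open>U\<close> are dominated by \<open>\<bar>U\<bar>\<close> pointwise, and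
averaging over a cell of length at most 1 increases a weighted norm at most by the factor \<open>K\<close> by which
the weight varies on such a cell (\<open>cell_avg_weighted\<close>). This factor depends on the weight only, which
makes the constants \<open>2 + K\<close> independent of \<open>Y\<close> and \<open>n\<close>.

The properties of \<open>Y\<close> itself come from its definition: \<open>H\<close> is the energy to the left of \<open>y\<close>, and a continuous
function is the integral of its weak derivative (\<open>weak_deriv_FTC\<close>), which gives \<open>q + h = 1\<close> from
\<open>y + H = id\<close> and the Lipschitz bound for \<open>U\<close> from \<open>\<bar>w\<bar> \<le> 1\<close>.
\<close>

section \<open>Essential suprema and square norms\<close>

lemma borel_measurable_lebesgue_if_borel:
  fixes f :: "real \<Rightarrow> real"
  assumes "f \<in> borel_measurable borel"
  shows "f \<in> borel_measurable lebesgue"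
  using assms by (simp add: measurable_completion)

lemma borel_measurable_lebesgue_continuous:
  fixes f :: "real \<Rightarrow> real"
  assumes "continuous_on UNIV f"
  shows "f \<in> borel_measurable lebesgue"
  by (intro borel_measurable_lebesgue_if_borel borel_measurable_continuous_onI assms)

lemma esssup_abs_nonneg:
  fixes f :: "real \<Rightarrow> real"
  shows "0 \<le> esssup lebesgue (\<lambda>x. ereal \<bar>f x\<bar>)"
proof (cases "(\<lambda>x. ereal \<bar>f x\<bar>) \<in> borel_measurable lebesgue")
  case True
  have "esssup lebesgue (\<lambda>x::real. 0::ereal) \<le> esssup lebesgue (\<lambda>x. ereal \<bar>f x\<bar>)"
    by (intro esssup_mono) auto
  moreover have "esssup lebesgue (\<lambda>x::real. 0::ereal) = 0"
    by (intro esssup_const) simp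
  ultimately show ?thesis by simp
next
  case False
  then show ?thesis by (simp add: esssup_non_measurable)
qed

lemma norm_Linf_nonneg: "0 \<le> norm_Linf f"
  unfolding norm_Linf_def by (intro real_of_ereal_pos esssup_abs_nonneg)

lemma esssup_abs_le:
  fixes f :: "real \<Rightarrow> real"
  assumes "f \<in> borel_measurable lebesgue" "AE x in lebesgue. \<bar>f x\<bar> \<le> C"
  shows "esssup lebesgue (\<lambda>x. ereal \<bar>f x\<bar>) \<le> ereal C"
  using assms by (intro esssup_I) auto

lemma in_LinfI:
  assumes "f \<in> borel_measurable lebesgue" "AE x in lebesgue. \<bar>f x\<bar> \<le> C"
  shows "in_Linf f"
  unfolding in_Linf_def using esssup_abs_le[OF assms] assms(1)
  by auto

lemma norm_Linf_le:
  assumes "f \<in> borel_measurable lebesgue" "AE x in lebesgue. \<bar>f x\<bar> \<le> C"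
  shows "norm_Linf f \<le> C"
proof -
  have "esssup lebesgue (\<lambda>x. ereal \<bar>f x\<bar>) \<noteq> -\<infinity>"
    using esssup_abs_nonneg[of f] by auto
  then show ?thesis
    unfolding norm_Linf_def using esssup_abs_le[OF assms] esssup_abs_nonneg[of f]
    by (cases "esssup lebesgue (\<lambda>x. ereal \<bar>f x\<bar>)") auto
qed

lemma AE_abs_le_norm_Linf:
  assumes "in_Linf f"
  shows "AE x in lebesgue. \<bar>f x\<bar> \<le> norm_Linf f"
proof -
  have "ereal (norm_Linf f) = esssup lebesgue (\<lambda>x. ereal \<bar>f x\<bar>)"
    using assms esssup_abs_nonneg[of f] unfolding norm_Linf_def in_Linf_def
    by (cases "esssup lebesgue (\<lambda>x. ereal \<bar>f x\<bar>)") auto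
  moreover have "AE x in lebesgue. ereal \<bar>f x\<bar> \<le> esssup lebesgue (\<lambda>x. ereal \<bar>f x\<bar>)"
    by (rule esssup_AE)
  ultimately show ?thesis by (metis (no_types, lifting) AE_cong ereal_less_eq(3))
qed

text \<open>The set where the bound fails is open and null, hence empty. This turns essential suprema of
\<open>H\<close> and \<open>\<zeta>\<close> into bounds at the grid points, which form a null set.\<close>

lemma continuous_abs_le_everywhere:
  fixes f :: "real \<Rightarrow> real"
  assumes f: "continuous_on UNIV f" and ae: "AE x in lebesgue. \<bar>f x\<bar> \<le> C"
  shows "\<bar>f x\<bar> \<le> C"
proof (rule ccontr)
  assume "\<not> \<bar>f x\<bar> \<le> C"
  then have ne: "{x. C < \<bar>f x\<bar>} \<noteq> {}" by (auto simp: not_le)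
  have op: "open {x. C < \<bar>f x\<bar>}"
    by (intro open_Collect_less continuous_intros f)
  have "AE x in lebesgue. x \<notin> {x. C < \<bar>f x\<bar>}"
    using ae by eventually_elim auto
  then have "{x. C < \<bar>f x\<bar>} \<in> null_sets lebesgue"
    using borel_open[OF op] by (simp add: AE_iff_null_sets)
  then show False
    using open_not_negligible[OF op ne] by (simp add: negligible_iff_null_sets)
qed

lemma continuous_abs_le_norm_Linf:
  assumes "continuous_on UNIV f" "in_Linf f"
  shows "\<bar>f x\<bar> \<le> norm_Linf f"
  by (rule continuous_abs_le_everywhere[OF assms(1) AE_abs_le_norm_Linf[OF assms(2)]])

lemma in_L2_bound:
  assumes "f \<in> borel_measurable lebesgue" "in_L2 g" "AE x in lebesgue. \<bar>f x\<bar> \<le> \<bar>g x\<bar>"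
  shows "in_L2 f" "norm_L2 f \<le> norm_L2 g"
proof -
  have g: "integrable lebesgue (\<lambda>x. (g x)\<^sup>2)" using assms(2) by (simp add: in_L2_def)
  have ae: "AE x in lebesgue. (f x)\<^sup>2 \<le> (g x)\<^sup>2"
    using assms(3) by eventually_elim (simp add: abs_le_square_iff)
  have f: "integrable lebesgue (\<lambda>x. (f x)\<^sup>2)"
    by (rule Bochner_Integration.integrable_bound[OF g]) (use assms(1) ae in auto)
  show "in_L2 f" using f assms(1) by (simp add: in_L2_def)
  show "norm_L2 f \<le> norm_L2 g"
    unfolding norm_L2_def by (intro real_sqrt_le_mono integral_mono_AE f g ae)
qed

section \<open>Weak derivatives of continuous functions\<close>

text \<open>The hat function on \<open>[0, 2]\<close> with integral one, and its primitive, a \<open>C\<^sup>1\<close> function rising from 0 to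
1 across \<open>[0, 2]\<close>. Writing both as combinations of powers of positive parts gives differentiability
from that of the square of the positive part alone.\<close>

definition bump :: "real \<Rightarrow> real" where
  "bump t = max 0 t - 2 * max 0 (t - 1) + max 0 (t - 2)"

definition bump_prim :: "real \<Rightarrow> real" where
  "bump_prim t = ((max 0 t)\<^sup>2 - 2 * (max 0 (t - 1))\<^sup>2 + (max 0 (t - 2))\<^sup>2) / 2"

lemma has_real_derivative_positive_part_square:
  "((\<lambda>t. (max 0 t)\<^sup>2) has_real_derivative 2 * max 0 t) (at (t::real))"
proof -
  consider "t < 0" | "t = 0" | "t > 0" by linarith
  then show ?thesis
  proof cases
    case 1
    have "((\<lambda>t. 0) has_real_derivative 2 * max 0 t) (at t)" using 1 by simp
    then show ?thesis
      by (rule has_field_derivative_transform_within_open[where S="{..<0}"]) (use 1 in auto)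
  next
    case 2
    have "((\<lambda>h::real. ((max 0 h)\<^sup>2) / h) \<longlongrightarrow> 0) (at 0)"
    proof (rule Lim_null_comparison)
      show "\<forall>\<^sub>F h::real in at 0. norm ((max 0 h)\<^sup>2 / h) \<le> \<bar>h\<bar>"
        by (intro always_eventually) (auto simp: max_def power2_eq_square)
      show "((\<lambda>h::real. \<bar>h\<bar>) \<longlongrightarrow> 0) (at 0)" by (intro tendsto_eq_intros refl) auto
    qed
    then show ?thesis using 2 by (simp add: DERIV_def)
  next
    case 3
    have "((\<lambda>t. t\<^sup>2) has_real_derivative 2 * max 0 t) (at t)"
      using 3 by (auto intro!: derivative_eq_intros)
    then show ?thesis
      by (rule has_field_derivative_transform_within_open[where S="{0<..}"]) (use 3 in auto)
  qed
qed

lemma bump_prim_deriv: "(bump_prim has_real_derivative bump t) (at t)"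
proof -
  have s: "((\<lambda>t. (max 0 (t - c))\<^sup>2) has_real_derivative 2 * max 0 (t - c) * 1) (at t)" for c :: real
    by (rule DERIV_chain2[where f = "\<lambda>t. (max 0 t)\<^sup>2" and g = "\<lambda>t. t - c",
          OF has_real_derivative_positive_part_square])
      (auto intro!: derivative_eq_intros)
  have "((\<lambda>t. ((max 0 (t - 0))\<^sup>2 - 2 * (max 0 (t - 1))\<^sup>2 + (max 0 (t - 2))\<^sup>2) / 2)
      has_real_derivative ((2 * max 0 (t - 0) * 1 - 2 * (2 * max 0 (t - 1) * 1)) + 2 * max 0 (t - 2) * 1) / 2) (at t)"
    by (intro DERIV_cdivide DERIV_add DERIV_diff DERIV_cmult s)
  then show ?thesis
    unfolding bump_prim_def[abs_def] bump_def by (simp add: diff_divide_distrib add_divide_distrib)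
qed

lemma continuous_bump: "continuous_on A bump"
  unfolding bump_def[abs_def] by (intro continuous_intros)

lemma bump_prim_left: "t \<le> 0 \<Longrightarrow> bump_prim t = 0"
  by (simp add: bump_prim_def)

lemma bump_prim_right: "t \<ge> 2 \<Longrightarrow> bump_prim t = 1"
  by (simp add: bump_prim_def max_def power2_eq_square algebra_simps)

lemma bump_nonneg: "0 \<le> bump t"
  and bump_outside: "t \<notin> {0..2} \<Longrightarrow> bump t = 0"
  by (auto simp: bump_def max_def)

lemma bump_prim_mono: "mono bump_prim"
proof (rule monoI)
  fix s t :: real
  assume "s \<le> t"
  then show "bump_prim s \<le> bump_prim t"
    by (rule DERIV_nonneg_imp_nondecreasing) (use bump_prim_deriv bump_nonneg in blast)
qed

lemma bump_prim_bounds: "0 \<le> bump_prim t" "bump_prim t \<le> 1"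
  using monoD[OF bump_prim_mono, of "min t 0" t] bump_prim_left[of "min t 0"]
    monoD[OF bump_prim_mono, of t "max t 2"] bump_prim_right[of "max t 2"]
  by linarith+

lemma integral_bump: "integrable lborel bump" "(LINT t|lborel. bump t) = 1"
proof -
  have i: "(\<lambda>t. indicator {0..2} t *\<^sub>R bump t) = bump"
    using bump_outside by (auto simp: indicator_def fun_eq_iff)
  show "(LINT t|lborel. bump t) = 1"
    using integral_FTC_Icc[of 0 2 bump_prim bump, unfolded i]
      has_field_derivative_at_within[OF bump_prim_deriv]
    by (simp add: continuous_bump bump_prim_left bump_prim_right has_real_derivative_iff_has_vector_derivative)
  show "integrable lborel bump"
    using borel_integrable_atLeastAtMost'[of 0 2 bump, OF continuous_bump]
    unfolding set_integrable_def i .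
qed

text \<open>After rescaling, the integrand is \<open>f (a + t / k) bump t\<close> with \<open>k = n + 1\<close>, and the kernel has mass one.\<close>

lemma mollify_tendsto:
  fixes f :: "real \<Rightarrow> real"
  assumes f: "continuous_on UNIV f"
  shows "(\<lambda>n. LINT x|lebesgue. f x * (real (Suc n) * bump (real (Suc n) * (x - a)))) \<longlonglongrightarrow> f a"
proof -
  have bm: "bump \<in> borel_measurable borel" "f \<in> borel_measurable borel"
    by (intro borel_measurable_continuous_onI continuous_bump f)+
  note bm[measurable]
  have eq: "(LINT x|lebesgue. f x * (k * bump (k * (x - a)))) = (LINT t|lborel. f (a + t / k) * bump t)"
    if k: "k > 0" for k :: real
  proof -
    have "(LINT x|lebesgue. f x * (k * bump (k * (x - a)))) = (LINT x|lborel. f x * (k * bump (k * (x - a))))"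
      by (rule integral_completion) measurable
    also have "\<dots> = \<bar>1 / k\<bar> *\<^sub>R
        (LINT t|lborel. f (a + 1 / k * t) * (k * bump (k * (a + 1 / k * t - a))))"
      by (rule lborel_integral_real_affine) (use k in simp)
    also have "(\<lambda>t. f (a + 1 / k * t) * (k * bump (k * (a + 1 / k * t - a))))
        = (\<lambda>t. k * (f (a + t / k) * bump t))"
      using k by (intro ext) simp
    finally show ?thesis using k by simp
  qed
  have "compact (f ` {a..a+2})"
    by (intro compact_continuous_image continuous_on_subset[OF f]) auto
  then obtain B where B: "\<And>x. x \<in> {a..a+2} \<Longrightarrow> \<bar>f x\<bar> \<le> B"
    using compact_imp_bounded[of "f ` {a..a+2}"] unfolding bounded_iff by force
  have "(\<lambda>n. LINT t|lborel. f (a + t / real (Suc n)) * bump t) \<longlonglongrightarrow> (LINT t|lborel. f a * bump t)"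
  proof (rule integral_dominated_convergence[where w="\<lambda>t. B * bump t"])
    show "AE t in lborel. (\<lambda>n. f (a + t / real (Suc n)) * bump t) \<longlonglongrightarrow> f a * bump t"
    proof (intro AE_I2 tendsto_mult tendsto_const)
      fix t
      have "(\<lambda>n. a + t / real (Suc n)) \<longlonglongrightarrow> a"
        using tendsto_add[OF tendsto_const[of a] LIMSEQ_Suc[OF lim_const_over_n[of t]]] by simp
      then show "(\<lambda>n. f (a + t / real (Suc n))) \<longlonglongrightarrow> f a"
        by (rule continuous_on_tendsto_compose[OF f]) auto
    qed
    show "AE t in lborel. norm (f (a + t / real (Suc n)) * bump t) \<le> B * bump t" for n
    proof (intro AE_I2)
      fix t :: real
      show "norm (f (a + t / real (Suc n)) * bump t) \<le> B * bump t"
      proof (cases "t \<in> {0..2}")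
        case True
        then have "t / real (Suc n) \<in> {0..2}"
          using divide_left_mono[of 1 "real (Suc n)" t] by auto
        then have "\<bar>f (a + t / real (Suc n))\<bar> \<le> B" by (intro B) auto
        then show ?thesis by (simp add: abs_mult bump_nonneg mult_right_mono del: of_nat_Suc)
      qed (simp add: bump_outside)
    qed
  qed (use integral_bump in auto)
  moreover have "0 < real (Suc n)" for n by simp
  ultimately show ?thesis unfolding eq[OF \<open>\<And>n. 0 < real (Suc n)\<close>] by (simp add: integral_bump)
qed

text \<open>The test function is the difference of two primitives of bumps, rescaled to width \<open>2 / (n + 1)\<close> and
placed at \<open>a\<close> and \<open>b\<close>. It converges to the indicator of the interval, while its derivative is a
difference of mollifiers, so that the definition of the weak derivative becomes the fundamental
theorem of calculus in the limit.\<close>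

lemma weak_deriv_FTC:
  assumes f: "continuous_on UNIV f" and fg: "weak_deriv f g" and ab: "a \<le> b"
  shows "f b - f a = (LINT x:{a..b}|lebesgue. g x)"
proof -
  define \<phi> where "\<phi> n x = bump_prim (real (Suc n) * (x - a)) - bump_prim (real (Suc n) * (x - b))" for n x
  define \<phi>' where "\<phi>' n x = real (Suc n) * bump (real (Suc n) * (x - a))
      - real (Suc n) * bump (real (Suc n) * (x - b))" for n x
  have out: "\<phi> n x = 0" if "x \<notin> {a..b+2}" for n x
  proof -
    have "real (Suc n) * (x - a) \<le> 0 \<and> real (Suc n) * (x - b) \<le> 0 \<or>
        2 \<le> real (Suc n) * (x - a) \<and> 2 \<le> real (Suc n) * (x - b)"
    proof (cases "x < a")
      case True
      then show ?thesis using ab by (intro disjI1 conjI mult_nonneg_nonpos) auto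
    next
      case False
      then have "2 \<le> x - b" using that by auto
      then have "1 * 2 \<le> real (Suc n) * (x - b)" by (intro mult_mono) auto
      moreover have "real (Suc n) * (x - b) \<le> real (Suc n) * (x - a)"
        using ab by (intro mult_left_mono) auto
      ultimately show ?thesis by linarith
    qed
    then show ?thesis unfolding \<phi>_def by (metis bump_prim_left bump_prim_right diff_self)
  qed
  have in01: "\<bar>\<phi> n x\<bar> \<le> 1" for n x
    unfolding \<phi>_def using bump_prim_bounds[of "real (Suc n) * (x - a)"]
      bump_prim_bounds[of "real (Suc n) * (x - b)"] by linarith
  have der: "(\<phi> n has_real_derivative \<phi>' n x) (at x)" for n x
  proof -
    have d: "((\<lambda>x. bump_prim (real (Suc n) * (x - c))) has_real_derivative
        bump (real (Suc n) * (x - c)) * real (Suc n)) (at x)" for c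
      by (rule DERIV_chain2[OF bump_prim_deriv]) (auto intro!: derivative_eq_intros)
    show ?thesis unfolding \<phi>_def[abs_def] \<phi>'_def
      using DERIV_diff[OF d[of a] d[of b]] by (simp add: mult.commute)
  qed
  have cont': "continuous_on UNIV (\<phi>' n)" for n
    unfolding \<phi>'_def
    by (intro continuous_intros continuous_on_compose2[OF continuous_bump[of UNIV]]) auto
  have cont: "continuous_on UNIV (\<phi> n)" for n
    by (intro continuous_at_imp_continuous_on ballI DERIV_isCont[OF der])
  have "x \<notin> {a..b+2}" if "\<bar>x\<bar> > \<bar>a\<bar> + \<bar>b\<bar> + 2" for x using that by auto
  then have supp: "\<exists>r. \<forall>x. \<bar>x\<bar> > r \<longrightarrow> \<phi> n x = 0" for n using out by blast
  have test: "(LINT x|lebesgue. f x * \<phi>' n x) = - (LINT x|lebesgue. g x * \<phi> n x)" for n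
    using fg der cont' supp unfolding weak_deriv_def by blast
  have g: "set_integrable lebesgue {c..d} g" for c d
    using fg by (auto simp: weak_deriv_def locally_integrable_def)
  have int: "integrable lebesgue (\<lambda>x. f x * (real (Suc n) * bump (real (Suc n) * (x - c))))" for n c
  proof -
    let ?k = "\<lambda>x. f x * (real (Suc n) * bump (real (Suc n) * (x - c)))"
    have ck: "continuous_on A ?k" for A
      by (intro continuous_intros continuous_on_subset[OF f]
          continuous_on_compose2[OF continuous_bump[of UNIV]]) auto
    have "set_integrable lebesgue {c..c+2} ?k"
      using borel_integrable_atLeastAtMost'[OF ck] borel_measurable_continuous_onI[OF ck]
      unfolding set_integrable_def by (subst integrable_completion) auto
    moreover have "indicator {c..c+2} x *\<^sub>R ?k x = ?k x" for x
    proof (cases "x \<in> {c..c+2}")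
      case False
      have "real (Suc n) * (x - c) \<notin> {0..2}"
      proof (cases "x < c")
        case True
        then have "\<not> 0 \<le> real (Suc n) * (x - c)" by (simp add: zero_le_mult_iff del: of_nat_Suc)
        then show ?thesis unfolding atLeastAtMost_iff by blast
      next
        case F: False
        have "2 < 1 * (x - c)" using False F by auto
        also have "\<dots> \<le> real (Suc n) * (x - c)" using F by (intro mult_right_mono) auto
        finally have "\<not> real (Suc n) * (x - c) \<le> 2" by (simp only: not_le)
        then show ?thesis unfolding atLeastAtMost_iff by blast
      qed
      then show ?thesis using bump_outside by simp
    qed simp
    ultimately show ?thesis unfolding set_integrable_def by (simp only:)
  qed
  have split: "(LINT x|lebesgue. f x * \<phi>' n x) =
      (LINT x|lebesgue. f x * (real (Suc n) * bump (real (Suc n) * (x - a))))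
      - (LINT x|lebesgue. f x * (real (Suc n) * bump (real (Suc n) * (x - b))))" for n
  proof -
    have "f x * \<phi>' n x = f x * (real (Suc n) * bump (real (Suc n) * (x - a)))
        - f x * (real (Suc n) * bump (real (Suc n) * (x - b)))" for x
      unfolding \<phi>'_def by (rule right_diff_distrib)
    then show ?thesis
      by (simp only:) (rule Bochner_Integration.integral_diff[OF int int])
  qed
  have lim1: "(\<lambda>n. LINT x|lebesgue. f x * \<phi>' n x) \<longlonglongrightarrow> f a - f b"
    unfolding split by (intro tendsto_diff mollify_tendsto f)
  have gm: "g \<in> borel_measurable lebesgue"
  proof (rule borel_measurable_LIMSEQ_real)
    show "(\<lambda>n. indicator {- real n..real n} x *\<^sub>R g x) \<longlonglongrightarrow> g x" for x
    proof (rule tendsto_eventually, rule eventually_sequentiallyI[of "nat \<lceil>\<bar>x\<bar>\<rceil>"])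
      fix n assume "nat \<lceil>\<bar>x\<bar>\<rceil> \<le> n"
      then have "\<bar>x\<bar> \<le> real n" by linarith
      then show "indicator {- real n..real n} x *\<^sub>R g x = g x" by (auto simp: indicator_def)
    qed
    show "(\<lambda>x. indicator {- real n..real n} x *\<^sub>R g x) \<in> borel_measurable lebesgue" for n
      using g[of "-real n" "real n"] unfolding set_integrable_def by auto
  qed
  have lim2: "(\<lambda>n. LINT x|lebesgue. g x * \<phi> n x) \<longlonglongrightarrow> (LINT x|lebesgue. indicator {a..b} x *\<^sub>R g x)"
  proof (rule integral_dominated_convergence[where w="\<lambda>x. \<bar>indicator {a..b+2} x *\<^sub>R g x\<bar>"])
    show "(\<lambda>x. indicator {a..b} x *\<^sub>R g x) \<in> borel_measurable lebesgue"
      using g[of a b] unfolding set_integrable_def by auto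
    show "(\<lambda>x. g x * \<phi> n x) \<in> borel_measurable lebesgue" for n
      using gm borel_measurable_lebesgue_continuous[OF cont[of n]] by measurable
    show "integrable lebesgue (\<lambda>x. \<bar>indicator {a..b+2} x *\<^sub>R g x\<bar>)"
      using g[of a "b+2"] unfolding set_integrable_def by (rule integrable_abs)
    show "AE x in lebesgue. norm (g x * \<phi> n x) \<le> \<bar>indicator {a..b+2} x *\<^sub>R g x\<bar>" for n
      using in01[of n] out[of _ n]
      by (intro AE_I2) (auto simp: indicator_def abs_mult mult_left_le)
    have "AE x in lebesgue. x \<noteq> a" by (intro AE_I'[of "{a}"]) auto
    then show "AE x in lebesgue. (\<lambda>n. g x * \<phi> n x) \<longlonglongrightarrow> indicator {a..b} x *\<^sub>R g x"
    proof eventually_elim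
      case (elim x)
      have ev: "\<forall>\<^sub>F n in sequentially. bump_prim (real (Suc n) * (x - c)) = (if c < x then 1 else 0)" for c
      proof (cases "c < x")
        case True
        obtain m where m: "2 / (x - c) < real m" using reals_Archimedean2 by blast
        show ?thesis
        proof (rule eventually_sequentiallyI[of m])
          fix n assume "m \<le> n"
          then have "2 / (x - c) \<le> real (Suc n)" using m by linarith
          then have "2 \<le> real (Suc n) * (x - c)" using True by (simp add: field_simps del: of_nat_Suc)
          then show "bump_prim (real (Suc n) * (x - c)) = (if c < x then 1 else 0)"
            using True bump_prim_right by simp
        qed
      next
        case False
        then have "real (Suc n) * (x - c) \<le> 0" for n by (intro mult_nonneg_nonpos) auto
        then show ?thesis using False by (simp add: bump_prim_left del: of_nat_Suc)
      qed
      show ?case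
      proof (rule tendsto_eventually)
        show "\<forall>\<^sub>F n in sequentially. g x * \<phi> n x = indicator {a..b} x *\<^sub>R g x"
          using ev[of a] ev[of b] 
        proof eventually_elim
          case (elim n) then show ?case
          using ab \<open>x \<noteq> a\<close> unfolding \<phi>_def by (auto simp: indicator_def simp del: of_nat_Suc)
        qed
      qed
    qed
  qed
  have "(\<lambda>n. LINT x|lebesgue. f x * \<phi>' n x) \<longlonglongrightarrow> - (LINT x|lebesgue. indicator {a..b} x *\<^sub>R g x)"
    unfolding test by (intro tendsto_minus lim2)
  from LIMSEQ_unique[OF lim1 this] show ?thesis
    unfolding set_lebesgue_integral_def by simp
qed

text \<open>Lebesgue differentiation: almost every value of \<open>g\<close> is the limit of its averages over shrinking
intervals, and these are all equal to \<open>c\<close>.\<close>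

lemma AE_eq_const_if_interval_integrals:
  assumes g: "locally_integrable g"
    and eq: "\<And>a b. a \<le> b \<Longrightarrow> (LINT x:{a..b}|lebesgue. g x) = c * (b - a)"
  shows "AE x in lebesgue. g x = c"
proof -
  have si: "set_integrable lebesgue {a..b} g" for a b
    using g by (simp add: locally_integrable_def)
  have "g integrable_on cbox a b" for a b
    using set_lebesgue_integral_eq_integral(1)[OF si[of a b]] by simp
  then obtain N where N: "negligible N"
    and d: "\<And>x e. x \<notin> N \<Longrightarrow> 0 < e \<Longrightarrow> \<exists>d>0. \<forall>h. 0 < h \<and> h < d \<longrightarrow>
        norm (integral (cbox x (x + h *\<^sub>R One)) g /\<^sub>R h ^ DIM(real) - g x) < e"
    using integrable_ccontinuous_explicit[of g] by (metis (no_types, lifting))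
  have "g x = c" if xN: "x \<notin> N" for x
  proof (rule ccontr)
    assume "g x \<noteq> c"
    then obtain d where "d > 0" and h: "\<And>h. 0 < h \<Longrightarrow> h < d \<Longrightarrow>
        norm (integral (cbox x (x + h *\<^sub>R One)) g /\<^sub>R h ^ DIM(real) - g x) < \<bar>c - g x\<bar>"
      using d[OF xN, of "\<bar>c - g x\<bar>"] by auto
    have "integral (cbox x (x + (d/2) *\<^sub>R One)) g = c * (d/2)"
      using set_lebesgue_integral_eq_integral(2)[OF si[of x "x + d/2"]] eq[of x "x + d/2"] \<open>d > 0\<close> by simp
    moreover have "(c * (d/2)) /\<^sub>R (d/2) ^ DIM(real) = c" using \<open>d > 0\<close> by simp
    ultimately show False
      using h[of "d/2"] \<open>d > 0\<close> by (simp only: real_norm_def) simp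
  qed
  then show ?thesis
    using N by (intro AE_I'[of N]) (auto simp: negligible_iff_null_sets)
qed

section \<open>The Lagrangian element of a function\<close>

lemma lipschitz_imp_continuous:
  fixes f :: "real \<Rightarrow> real"
  assumes "\<And>x z. x \<le> z \<Longrightarrow> \<bar>f z - f x\<bar> \<le> z - x"
  shows "continuous_on UNIV f"
proof -
  have "1-lipschitz_on UNIV f"
  proof (rule lipschitz_onI)
    fix x z :: real
    show "dist (f x) (f z) \<le> 1 * dist x z"
      using assms[of x z] assms[of z x] by (cases "x \<le> z") (auto simp: dist_real_def)
  qed simp
  then show ?thesis by (rule lipschitz_on_continuous_on)
qed

text \<open>All that is needed of the equation defining \<open>y\<close>: the energy left of \<open>y\<close> is an increasing function of
\<open>y\<close> that vanishes at the left and is bounded, and \<open>H\<close> is this function composed with \<open>y\<close>.\<close>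

lemma lagr_of_energy:
  assumes u: "in_H1 u" and Y: "lagr_of u Y"
  obtains B where
    "\<And>x z. x \<le> z \<Longrightarrow> HL Y x \<le> HL Y z"
    "\<And>x z. x \<le> z \<Longrightarrow> HL Y z - HL Y x \<le> z - x"
    "\<And>x. 0 \<le> HL Y x" "\<And>x. HL Y x \<le> B" "(HL Y \<longlongrightarrow> 0) at_bot"
    "\<And>x. zetaL Y x = - HL Y x"
proof -
  obtain ux where ux: "in_L2 ux"
    and y: "\<And>\<xi>. yL Y \<xi> + (LINT x:{..yL Y \<xi>}|lebesgue. (u x)\<^sup>2 + (ux x)\<^sup>2) = \<xi>"
    and H: "\<And>\<xi>. HL Y \<xi> = \<xi> - yL Y \<xi>"
    using Y unfolding lagr_of_def by blast
  define \<rho> where "\<rho> x = (u x)\<^sup>2 + (ux x)\<^sup>2" for x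
  define M where "M x = (LINT t:{..x}|lebesgue. \<rho> t)" for x
  have \<rho>: "integrable lebesgue \<rho>"
    unfolding \<rho>_def using u ux by (auto simp: in_H1_def in_L2_def)
  have si: "set_integrable lebesgue A \<rho>" if "A \<in> sets lebesgue" for A
    using \<rho> that unfolding set_integrable_def
    by (simp only: real_scaleR_def) (rule integrable_real_mult_indicator[of A lebesgue \<rho>, unfolded mult.commute[of _ "indicator _ _"]])
  have \<rho>0: "0 \<le> \<rho> x" for x by (simp add: \<rho>_def)
  have HM: "HL Y \<xi> = M (yL Y \<xi>)" for \<xi>
    using y[of \<xi>] H[of \<xi>] by (simp add: M_def \<rho>_def)
  have mono: "M a \<le> M b" if "a \<le> b" for a b
    unfolding M_def set_lebesgue_integral_def
    using si[of "{..a}"] si[of "{..b}"] that \<rho>0 unfolding set_integrable_def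
    by (intro integral_mono) (auto simp: indicator_def)
  have M0: "0 \<le> M a" for a
    unfolding M_def set_lebesgue_integral_def
    by (intro Bochner_Integration.integral_nonneg) (simp add: \<rho>0)
  have MB: "M a \<le> (LINT t|lebesgue. \<rho> t)" for a
    unfolding M_def set_lebesgue_integral_def
    using si[of "{..a}"] \<rho>0 \<rho> unfolding set_integrable_def
    by (intro integral_mono) (auto simp: indicator_def)
  \<comment> \<open>\<open>y + M y\<close> is strictly increasing in \<open>y\<close>, so \<open>y\<close> is increasing, and then both \<open>y\<close> and
    \<open>H = M \<circ> y\<close> increase at most as fast as their sum \<open>\<xi>\<close>\<close>
  have ymono: "yL Y x \<le> yL Y z" if "x \<le> z" for x z
    using mono[of "yL Y z" "yL Y x"] HM[of x] HM[of z] H[of x] H[of z] that by linarith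
  have Hmono: "HL Y x \<le> HL Y z" if "x \<le> z" for x z
    using mono[OF ymono[OF that]] by (simp add: HM)
  have Hlip: "HL Y z - HL Y x \<le> z - x" if "x \<le> z" for x z
    using ymono[OF that] H[of x] H[of z] by linarith
  have "(M \<longlongrightarrow> 0) at_bot"
  proof (rule tendsto_at_botI_sequentially)
    fix X :: "nat \<Rightarrow> real" assume X: "filterlim X at_bot sequentially"
    have "(\<lambda>n. LINT t|lebesgue. indicator {..X n} t *\<^sub>R \<rho> t) \<longlonglongrightarrow> (LINT t::real|lebesgue. (0::real))"
    proof (rule integral_dominated_convergence[where w=\<rho>])
      show "AE t in lebesgue. (\<lambda>n. indicator {..X n} t *\<^sub>R \<rho> t) \<longlonglongrightarrow> 0"
      proof (intro AE_I2 tendsto_eventually)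
        fix t
        have "\<forall>\<^sub>F n in sequentially. X n < t"
          using X by (simp add: filterlim_at_bot_dense)
        then show "\<forall>\<^sub>F n in sequentially. indicator {..X n} t *\<^sub>R \<rho> t = 0"
          by eventually_elim simp
      qed
      show "(\<lambda>t. indicator {..X n} t *\<^sub>R \<rho> t) \<in> borel_measurable lebesgue" for n
        using si[of "{..X n}"] unfolding set_integrable_def by (intro borel_measurable_integrable) simp
    qed (use \<rho> \<rho>0 in \<open>auto simp: indicator_def\<close>)
    then show "(\<lambda>n. M (X n)) \<longlonglongrightarrow> 0" by (simp add: M_def set_lebesgue_integral_def)
  qed
  then have "(HL Y \<longlongrightarrow> 0) at_bot"
  proof (rule tendsto_sandwich[OF _ _ tendsto_const, rotated 2])
    show "\<forall>\<^sub>F \<xi> in at_bot. 0 \<le> HL Y \<xi>" by (simp add: HM M0)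
    have "yL Y \<xi> \<le> \<xi>" for \<xi> using H[of \<xi>] M0[of "yL Y \<xi>"] HM[of \<xi>] by linarith
    then show "\<forall>\<^sub>F \<xi> in at_bot. HL Y \<xi> \<le> M \<xi>" by (simp add: HM mono)
  qed
  moreover have "zetaL Y x = - HL Y x" for x
    using H[of x] by (simp add: yL_def)
  ultimately show ?thesis
    using that[of "LINT t|lebesgue. \<rho> t"] Hmono Hlip M0 MB HM by metis
qed

text \<open>The normalization \<open>q + h = 1\<close> comes from \<open>y + H = id\<close>: by the fundamental theorem of calculus the
integral of \<open>q + h\<close> over an interval is the length of the interval.\<close>

lemma G_set_lagr_of_qh:
  assumes u: "in_H1 u" and Y: "lagr_of u Y" and G: "Y \<in> G_set"
  shows "AE \<xi> in lebesgue. qL Y \<xi> + hL Y \<xi> = 1 \<and> 0 \<le> qL Y \<xi> \<and> 0 \<le> hL Y \<xi> \<and>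
    qL Y \<xi> * hL Y \<xi> = (UL Y \<xi>)\<^sup>2 * (qL Y \<xi>)\<^sup>2 + (wL Y \<xi>)\<^sup>2"
proof -
  obtain B where mono: "\<And>x z. x \<le> z \<Longrightarrow> HL Y x \<le> HL Y z"
    and lip: "\<And>x z. x \<le> z \<Longrightarrow> HL Y z - HL Y x \<le> z - x"
    by (rule lagr_of_energy[OF u Y]) blast
  have wy: "weak_deriv (yL Y) (qL Y)" and wH: "weak_deriv (HL Y) (hL Y)"
    and yH: "\<And>\<xi>. HL Y \<xi> = \<xi> - yL Y \<xi>"
    using Y by (auto simp: lagr_of_def)
  have cH: "continuous_on UNIV (HL Y)"
  proof (rule lipschitz_imp_continuous)
    fix x z :: real assume "x \<le> z"
    then show "\<bar>HL Y z - HL Y x\<bar> \<le> z - x" using mono[of x z] lip[of x z] by linarith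
  qed
  have cy: "continuous_on UNIV (yL Y)"
    by (rule continuous_on_eq[OF continuous_on_diff[OF continuous_on_id cH]]) (use yH in force)
  have si: "set_integrable lebesgue {a..b} (qL Y)" "set_integrable lebesgue {a..b} (hL Y)" for a b
    using wy wH by (auto simp: weak_deriv_def locally_integrable_def)
  have "AE \<xi> in lebesgue. qL Y \<xi> + hL Y \<xi> = 1"
  proof (rule AE_eq_const_if_interval_integrals)
    show "locally_integrable (\<lambda>\<xi>. qL Y \<xi> + hL Y \<xi>)"
      unfolding locally_integrable_def by (intro allI set_integral_add si)
    fix a b :: real assume ab: "a \<le> b"
    have "(LINT x:{a..b}|lebesgue. qL Y x + hL Y x) =
        (LINT x:{a..b}|lebesgue. qL Y x) + (LINT x:{a..b}|lebesgue. hL Y x)"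
      by (rule set_integral_add(2)[OF si])
    also have "\<dots> = (yL Y b - yL Y a) + (HL Y b - HL Y a)"
      by (simp only: weak_deriv_FTC[OF cy wy ab] weak_deriv_FTC[OF cH wH ab])
    also have "\<dots> = 1 * (b - a)" unfolding yH by simp
    finally show "(LINT x:{a..b}|lebesgue. qL Y x + hL Y x) = 1 * (b - a)" .
  qed
  moreover have "AE \<xi> in lebesgue. 0 \<le> qL Y \<xi>" "AE \<xi> in lebesgue. 0 \<le> hL Y \<xi>"
    "AE \<xi> in lebesgue. qL Y \<xi> * hL Y \<xi> = (UL Y \<xi>)\<^sup>2 * (qL Y \<xi>)\<^sup>2 + (wL Y \<xi>)\<^sup>2"
    using G by (auto simp: G_set_def)
  ultimately show ?thesis by eventually_elim simp
qed

lemma integrable_indicator_Icc: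
  fixes a b :: real
  shows "integrable lebesgue (indicator {a..b} :: real \<Rightarrow> real)"
  using lmeasurable_interval(1)[of a b] by (intro integrable_real_indicator) (auto simp: fmeasurable_def)

text \<open>The relation \<open>q h = U\<^sup>2 q\<^sup>2 + w\<^sup>2\<close> with \<open>q + h = 1\<close> bounds \<open>w\<^sup>2\<close> by \<open>q h \<le> 1\<close>, and \<open>w\<close> is the derivative of
\<open>U\<close>.\<close>

lemma lagr_of_U_lipschitz:
  assumes u: "in_H1 u" and Y: "lagr_of u Y" and G: "Y \<in> G_set" and xz: "x \<le> z"
  shows "\<bar>UL Y z - UL Y x\<bar> \<le> z - x"
proof -
  obtain B where mono: "\<And>x z. x \<le> z \<Longrightarrow> HL Y x \<le> HL Y z"
    and lip: "\<And>x z. x \<le> z \<Longrightarrow> HL Y z - HL Y x \<le> z - x"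
    by (rule lagr_of_energy[OF u Y]) blast
  obtain ut where ut: "continuous_on UNIV ut" "\<And>\<xi>. UL Y \<xi> = ut (yL Y \<xi>)"
    and wU: "weak_deriv (UL Y) (wL Y)" and yH: "\<And>\<xi>. HL Y \<xi> = \<xi> - yL Y \<xi>"
    using Y unfolding lagr_of_def by blast
  have "continuous_on UNIV (yL Y)"
  proof (rule lipschitz_imp_continuous)
    fix x z :: real assume "x \<le> z"
    then show "\<bar>yL Y z - yL Y x\<bar> \<le> z - x"
      using mono[of x z] lip[of x z] yH[of x] yH[of z] by linarith
  qed
  then have "continuous_on UNIV (\<lambda>\<xi>. ut (yL Y \<xi>))"
    by (rule continuous_on_compose2[OF ut(1)]) auto
  then have cU: "continuous_on UNIV (UL Y)"
    by (rule continuous_on_eq) (simp add: ut(2))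
  have w1: "AE \<xi> in lebesgue. \<bar>wL Y \<xi>\<bar> \<le> 1"
    using G_set_lagr_of_qh[OF u Y G]
  proof eventually_elim
    case (elim \<xi>)
    have "(wL Y \<xi>)\<^sup>2 \<le> qL Y \<xi> * hL Y \<xi>" using elim by simp
    also have "\<dots> \<le> 1 * 1" using elim by (intro mult_mono) auto
    finally show ?case by (simp add: abs_square_le_1)
  qed
  have si: "set_integrable lebesgue {x..z} (wL Y)"
    using wU by (auto simp: weak_deriv_def locally_integrable_def)
  have "UL Y z - UL Y x = (LINT t:{x..z}|lebesgue. wL Y t)"
    by (rule weak_deriv_FTC[OF cU wU xz])
  also have "\<bar>\<dots>\<bar> \<le> (LINT t:{x..z}|lebesgue. 1)"
    unfolding set_lebesgue_integral_def
  proof (rule order_trans[OF integral_abs_bound], rule integral_mono_AE)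
    show "AE t in lebesgue. \<bar>indicator {x..z} t *\<^sub>R wL Y t\<bar> \<le> indicator {x..z} t *\<^sub>R 1"
      using w1 by eventually_elim (auto simp: indicator_def)
    show "integrable lebesgue (\<lambda>t. indicator {x..z} t *\<^sub>R 1 :: real)"
      using integrable_indicator_Icc[of x z] by simp
  qed (use si in \<open>auto simp: set_integrable_def\<close>)
  also have "\<dots> = z - x" using xz by (simp add: set_lebesgue_integral_def)
  finally show ?thesis .
qed

lemma open_Collect_abs_gt_measurable: "{x::real. r < \<bar>x\<bar>} \<in> sets lebesgue"
proof -
  have "open {x::real. r < \<bar>x\<bar>}" by (intro open_Collect_less continuous_intros)
  then show ?thesis using borel_open by auto
qed

lemma tail_integral_tendsto_0:
  fixes f :: "real \<Rightarrow> real"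
  assumes f: "integrable lebesgue f"
  shows "(\<lambda>n. LINT x|lebesgue. indicator {x. real n < \<bar>x\<bar>} x * \<bar>f x\<bar>) \<longlonglongrightarrow> 0"
proof -
  have m: "{x. real n < \<bar>x\<bar>} \<in> sets lebesgue" for n
    by (rule open_Collect_abs_gt_measurable)
  have "(\<lambda>n. LINT x|lebesgue. indicator {x. real n < \<bar>x\<bar>} x * \<bar>f x\<bar>) \<longlonglongrightarrow> (LINT x::real|lebesgue. 0)"
  proof (rule integral_dominated_convergence[where w="\<lambda>x. \<bar>f x\<bar>"])
    show "AE x in lebesgue. (\<lambda>n. indicator {x. real n < \<bar>x\<bar>} x * \<bar>f x\<bar>) \<longlonglongrightarrow> 0"
    proof (intro AE_I2 tendsto_eventually eventually_sequentiallyI)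
      fix x :: real and n assume "nat \<lceil>\<bar>x\<bar>\<rceil> \<le> n"
      then have "\<bar>x\<bar> \<le> real n" by linarith
      then show "indicator {x. real n < \<bar>x\<bar>} x * \<bar>f x\<bar> = 0" by simp
    qed
    show "(\<lambda>x. indicator {x. real n < \<bar>x\<bar>} x * \<bar>f x\<bar>) \<in> borel_measurable lebesgue" for n
      using f m[of n] by (intro borel_measurable_times borel_measurable_indicator borel_measurable_abs) auto
  qed (use f in \<open>auto simp: indicator_def\<close>)
  then show ?thesis by simp
qed

text \<open>Where \<open>\<bar>f x\<bar> \<ge> e\<close>, the Lipschitz bound keeps \<open>\<bar>f\<bar>\<close> above \<open>e / 2\<close> on an interval of length \<open>e\<close>, which carries at
least \<open>e\<^sup>3 / 4\<close> of the integral of \<open>f\<^sup>2\<close>; far out, less than this is left.\<close>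

lemma lipschitz_L2_vanishes_at_infinity:
  fixes f :: "real \<Rightarrow> real"
  assumes lip: "\<And>x z. x \<le> z \<Longrightarrow> \<bar>f z - f x\<bar> \<le> z - x"
    and L2: "in_L2 f" and e: "0 < e"
  obtains R where "\<And>x. R \<le> \<bar>x\<bar> \<Longrightarrow> \<bar>f x\<bar> < e"
proof -
  have f2: "integrable lebesgue (\<lambda>x. (f x)\<^sup>2)" using L2 by (simp add: in_L2_def)
  have "\<forall>\<^sub>F n in sequentially. (LINT x|lebesgue. indicator {x. real n < \<bar>x\<bar>} x * \<bar>(f x)\<^sup>2\<bar>) < e ^ 3 / 4"
    by (rule order_tendstoD(2)[OF tail_integral_tendsto_0[OF f2]]) (use e in simp)
  then obtain n where n: "(LINT x|lebesgue. indicator {x. real n < \<bar>x\<bar>} x * (f x)\<^sup>2) < e ^ 3 / 4"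
    by (auto simp: eventually_sequentially)
  have m: "{x. real n < \<bar>x\<bar>} \<in> sets lebesgue"
    by (rule open_Collect_abs_gt_measurable)
  have "\<bar>f x\<bar> < e" if x: "real n + e \<le> \<bar>x\<bar>" for x
  proof (rule ccontr)
    assume "\<not> \<bar>f x\<bar> < e"
    then have fx: "e \<le> \<bar>f x\<bar>" by simp
    have "e ^ 3 / 4 = (LINT t|lebesgue. indicator {x - e/2..x + e/2} t * (e\<^sup>2 / 4))"
      using e by (simp add: power2_eq_square power3_eq_cube)
    also have "\<dots> \<le> (LINT t|lebesgue. indicator {x. real n < \<bar>x\<bar>} t * (f t)\<^sup>2)"
    proof (rule integral_mono)
      show "integrable lebesgue (\<lambda>t. indicator {x. real n < \<bar>x\<bar>} t * (f t)\<^sup>2)"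
        using integrable_real_mult_indicator[OF m f2] by (simp add: mult.commute)
      show "indicator {x - e/2..x + e/2} t * (e\<^sup>2 / 4) \<le> indicator {x. real n < \<bar>x\<bar>} t * (f t)\<^sup>2" for t
      proof (cases "t \<in> {x - e/2..x + e/2}")
        case True
        then have "\<bar>f t - f x\<bar> \<le> e / 2"
          using lip[of t x] lip[of x t] by (cases "t \<le> x") (auto simp: abs_minus_commute)
        then have "e / 2 \<le> \<bar>f t\<bar>" using fx by linarith
        then have "(e / 2)\<^sup>2 \<le> \<bar>f t\<bar>\<^sup>2" using e by (intro power_mono) auto
        moreover have "real n < \<bar>t\<bar>" using x True e by auto
        ultimately show ?thesis using True by (simp add: power_divide)
      qed simp
    qed (rule integrable_mult_left, rule integrable_indicator_Icc)
    finally show False using n by simp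
  qed
  then show ?thesis using that by blast
qed

section \<open>Averages over grid cells\<close>

definition cell :: "real \<Rightarrow> int \<Rightarrow> real set" where
  "cell d i = {of_int i * d ..< of_int (i + 1) * d}"

text \<open>Grid functions are given by their sequence of values. The cell that contains \<open>\<xi>\<close> has index
\<open>\<lfloor>\<xi> / d\<rfloor>\<close>, which makes evaluation and measurability immediate.\<close>

definition step_fun :: "real \<Rightarrow> (int \<Rightarrow> real) \<Rightarrow> real \<Rightarrow> real" where
  "step_fun d F \<xi> = F \<lfloor>\<xi> / d\<rfloor>"

definition cell_mean :: "real \<Rightarrow> (real \<Rightarrow> real) \<Rightarrow> int \<Rightarrow> real" where
  "cell_mean d f i = (LINT x:cell d i|lebesgue. f x) / d"

definition window :: "nat \<Rightarrow> (int \<Rightarrow> real) \<Rightarrow> int \<Rightarrow> real" where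
  "window N F i = (if - int N \<le> i \<and> i < int N then F i else 0)"

definition cell_avg :: "real \<Rightarrow> nat \<Rightarrow> (real \<Rightarrow> real) \<Rightarrow> real \<Rightarrow> real" where
  "cell_avg d N f = step_fun d (window N (cell_mean d f))"

lemma mem_cell_iff:
  assumes "0 < d"
  shows "\<xi> \<in> cell d i \<longleftrightarrow> \<lfloor>\<xi> / d\<rfloor> = i"
  unfolding cell_def floor_eq_iff using assms by (simp add: pos_le_divide_eq pos_divide_less_eq)

lemma mem_own_cell: "0 < d \<Longrightarrow> \<xi> \<in> cell d \<lfloor>\<xi> / d\<rfloor>"
  by (simp add: mem_cell_iff)

lemma cell_dist: "\<xi> \<in> cell d i \<Longrightarrow> \<eta> \<in> cell d i \<Longrightarrow> \<bar>\<xi> - \<eta>\<bar> \<le> d"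
  unfolding cell_def by (auto simp: algebra_simps)

lemma cell_sets [simp]: "cell d i \<in> sets lebesgue"
  unfolding cell_def by simp

lemma cell_indicator_integral:
  assumes "0 < d"
  shows "integrable lebesgue (indicator (cell d i) :: real \<Rightarrow> real)"
    "(LINT x|lebesgue. indicator (cell d i) x) = d"
proof -
  have e: "emeasure lebesgue (cell d i) = ennreal d"
    using assms unfolding cell_def by (simp add: algebra_simps)
  show "integrable lebesgue (indicator (cell d i) :: real \<Rightarrow> real)"
    by (rule integrable_real_indicator) (simp_all add: e)
  show "(LINT x|lebesgue. indicator (cell d i) x) = d"
    using assms e by (simp add: measure_def)
qed

lemma step_fun_measurable: "step_fun d F \<in> borel_measurable lebesgue"
proof -
  have "(\<lambda>\<xi>::real. \<lfloor>\<xi> / d\<rfloor>) \<in> measurable borel (count_space UNIV)" by measurable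
  then have "(\<lambda>\<xi>::real. F \<lfloor>\<xi> / d\<rfloor>) \<in> borel_measurable borel"
    by (rule measurable_compose) simp
  then show ?thesis
    unfolding step_fun_def[abs_def] by (rule borel_measurable_lebesgue_if_borel)
qed

lemma grid_const_step_fun:
  assumes "0 < d"
  shows "grid_const d (step_fun d F)"
  unfolding grid_const_def
proof (intro allI ballI)
  fix i :: int and \<xi> assume "\<xi> \<in> {of_int i * d..<of_int (i + 1) * d}"
  then have "\<lfloor>\<xi> / d\<rfloor> = i" using mem_cell_iff[OF assms] by (simp add: cell_def)
  then show "step_fun d F \<xi> = step_fun d F (of_int i * d)"
    using assms by (simp add: step_fun_def)
qed

lemma window_iff:
  assumes "0 < d"
  shows "- int N \<le> \<lfloor>\<xi> / d\<rfloor> \<and> \<lfloor>\<xi> / d\<rfloor> < int N \<longleftrightarrow> - (real N * d) \<le> \<xi> \<and> \<xi> < real N * d"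
proof -
  have "- int N \<le> \<lfloor>\<xi> / d\<rfloor> \<longleftrightarrow> - real N \<le> \<xi> / d"
    by (subst le_floor_iff) simp
  moreover have "\<lfloor>\<xi> / d\<rfloor> < int N \<longleftrightarrow> \<xi> / d < real N"
    by (subst floor_less_iff) simp
  ultimately show ?thesis
    using assms by (simp add: pos_le_divide_eq pos_divide_less_eq)
qed

lemma window_step_fun_outside:
  assumes "0 < d" "\<xi> \<in> {..<- (real N * d)} \<union> {real N * d..}"
  shows "step_fun d (window N F) \<xi> = 0"
  using window_iff[OF assms(1), of N \<xi>] assms(2) by (auto simp: step_fun_def window_def)

lemma step_fun_eq_sum:
  assumes "0 < d"
  shows "step_fun d (window N F) \<xi> = (\<Sum>i\<in>{- int N..<int N}. F i * indicator (cell d i) \<xi>)"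
proof -
  have "(\<Sum>i\<in>{- int N..<int N}. F i * indicator (cell d i) \<xi>)
      = (\<Sum>i\<in>{- int N..<int N}. if \<lfloor>\<xi> / d\<rfloor> = i then F i else 0)"
    by (intro sum.cong) (auto simp: indicator_def mem_cell_iff[OF assms])
  also have "\<dots> = step_fun d (window N F) \<xi>"
    by (simp add: step_fun_def window_def)
  finally show ?thesis by simp
qed

lemma in_L2_imp_set_integrable:
  assumes f: "in_L2 f" and A: "A \<in> sets lebesgue" "integrable lebesgue (indicator A :: real \<Rightarrow> real)"
  shows "set_integrable lebesgue A f"
  unfolding set_integrable_def
proof (rule Bochner_Integration.integrable_bound)
  show "integrable lebesgue (\<lambda>x. indicator A x + (f x)\<^sup>2 :: real)"
    using f A by (auto simp: in_L2_def)
  show "(\<lambda>x. indicator A x *\<^sub>R f x) \<in> borel_measurable lebesgue"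
    using f A by (intro borel_measurable_scaleR borel_measurable_indicator) (auto simp: in_L2_def)
  have "\<bar>t\<bar> \<le> 1 + t\<^sup>2" for t :: real
    using zero_le_power2[of "\<bar>t\<bar> - 1"] unfolding power2_diff power2_abs by simp
  then show "AE x in lebesgue. norm (indicator A x *\<^sub>R f x) \<le> norm (indicator A x + (f x)\<^sup>2 :: real)"
    by (intro AE_I2) (auto simp: indicator_def)
qed

lemma in_L2_cell: "in_L2 f \<Longrightarrow> 0 < d \<Longrightarrow> set_integrable lebesgue (cell d i) f"
  by (intro in_L2_imp_set_integrable cell_indicator_integral) simp_all

lemma integrable_cell: "integrable lebesgue f \<Longrightarrow> set_integrable lebesgue (cell d i) (f :: real \<Rightarrow> real)"
  unfolding set_integrable_def by (rule integrable_mult_indicator[OF cell_sets])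

lemma cell_mean_mono_AE:
  assumes "0 < d" "set_integrable lebesgue (cell d i) f" "set_integrable lebesgue (cell d i) g"
    and "AE x in lebesgue. x \<in> cell d i \<longrightarrow> f x \<le> g x"
  shows "cell_mean d f i \<le> cell_mean d g i"
  unfolding cell_mean_def using assms
  by (intro divide_right_mono set_integral_mono_AE) auto

lemma cell_mean_const: "0 < d \<Longrightarrow> cell_mean d (\<lambda>x. c) i = c"
  using cell_indicator_integral(2)[of d i]
  by (simp add: cell_mean_def set_lebesgue_integral_def)

lemma const_cell: "0 < d \<Longrightarrow> set_integrable lebesgue (cell d i) (\<lambda>x. c :: real)"
  unfolding set_integrable_def real_scaleR_def
  by (rule integrable_mult_left, rule cell_indicator_integral)

lemma cell_mean_bounds:
  assumes "0 < d" "set_integrable lebesgue (cell d i) f"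
  shows "AE x in lebesgue. x \<in> cell d i \<longrightarrow> f x \<le> b \<Longrightarrow> cell_mean d f i \<le> b"
    "AE x in lebesgue. x \<in> cell d i \<longrightarrow> a \<le> f x \<Longrightarrow> a \<le> cell_mean d f i"
  using cell_mean_mono_AE[OF assms const_cell[OF assms(1), of i b]]
    cell_mean_mono_AE[OF assms(1) const_cell[OF assms(1), of i a] assms(2)]
  by (simp_all add: cell_mean_const[OF assms(1)])

lemma cell_mean_linear:
  assumes "set_integrable lebesgue (cell d i) f" "set_integrable lebesgue (cell d i) g"
  shows "cell_mean d (\<lambda>x. f x + g x) i = cell_mean d f i + cell_mean d g i"
    "cell_mean d (\<lambda>x. f x - g x) i = cell_mean d f i - cell_mean d g i"
    "cell_mean d (\<lambda>x. c * f x) i = c * cell_mean d f i"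
  using assms unfolding cell_mean_def
  by (simp_all add: add_divide_distrib diff_divide_distrib)

text \<open>Jensen's inequality: the mean of \<open>(f - m)\<^sup>2\<close> is nonnegative for the mean \<open>m\<close> of \<open>f\<close>.\<close>

lemma cell_mean_square_le:
  assumes d: "0 < d" and f: "set_integrable lebesgue (cell d i) f"
    and f2: "set_integrable lebesgue (cell d i) (\<lambda>x. (f x)\<^sup>2)"
  shows "(cell_mean d f i)\<^sup>2 \<le> cell_mean d (\<lambda>x. (f x)\<^sup>2) i"
proof -
  define m where "m = cell_mean d f i"
  have mf: "set_integrable lebesgue (cell d i) (\<lambda>x. 2 * m * f x)"
    using f by simp
  have s: "set_integrable lebesgue (cell d i) (\<lambda>x. (f x)\<^sup>2 - 2 * m * f x)"
    by (intro set_integral_diff f2 mf)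
  have "0 \<le> cell_mean d (\<lambda>x. ((f x)\<^sup>2 - 2 * m * f x) + m\<^sup>2) i"
  proof (rule cell_mean_bounds(2)[OF d])
    show "set_integrable lebesgue (cell d i) (\<lambda>x. (f x)\<^sup>2 - 2 * m * f x + m\<^sup>2)"
      by (intro set_integral_add s const_cell d)
    have "0 \<le> (f x - m)\<^sup>2" for x by simp
    then show "AE x in lebesgue. x \<in> cell d i \<longrightarrow> 0 \<le> (f x)\<^sup>2 - 2 * m * f x + m\<^sup>2"
      by (intro AE_I2) (simp add: power2_diff algebra_simps)
  qed
  also have "\<dots> = cell_mean d (\<lambda>x. (f x)\<^sup>2) i - 2 * m * m + m\<^sup>2"
    by (simp only: cell_mean_linear(1)[OF s const_cell[OF d]] cell_mean_linear(2)[OF f2 mf]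
      cell_mean_linear(3)[OF f f] cell_mean_const[OF d] m_def[symmetric])
  finally show ?thesis unfolding m_def[symmetric] by (simp add: power2_eq_square)
qed

lemma cell_avg_measurable: "cell_avg d N f \<in> borel_measurable lebesgue"
  unfolding cell_avg_def by (rule step_fun_measurable)

lemma cell_avg_bound:
  assumes d: "0 < d" and f: "\<And>i. set_integrable lebesgue (cell d i) f"
    and C: "AE x in lebesgue. \<bar>f x\<bar> \<le> C" "0 \<le> C"
  shows "\<bar>cell_avg d N f \<xi>\<bar> \<le> C"
proof -
  have ae: "AE x in lebesgue. x \<in> cell d i \<longrightarrow> f x \<le> C" "AE x in lebesgue. x \<in> cell d i \<longrightarrow> - C \<le> f x" for i
    using C(1) by (eventually_elim, auto)+
  have "cell_mean d f i \<le> C" "- C \<le> cell_mean d f i" for i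
    using cell_mean_bounds[OF d f] ae by auto
  then show ?thesis
    using C(2) unfolding cell_avg_def step_fun_def window_def by (auto simp: abs_le_iff minus_le_iff)
qed

text \<open>On one cell the weight varies by at most the factor \<open>K\<close>, so it can be moved from outside the mean
to inside at the cost of \<open>K\<close>; then the cells are summed. Both the plain contraction (weight 1) and
the exponential and polynomial weights are instances.\<close>

lemma cell_avg_weighted:
  assumes d: "0 < d" and g: "\<And>i. set_integrable lebesgue (cell d i) g"
    and g0: "AE x in lebesgue. 0 \<le> g x"
    and s: "s \<in> borel_measurable lebesgue" "\<And>x. 0 \<le> s x"
    and K: "0 \<le> K" "\<And>x z. \<bar>x - z\<bar> \<le> d \<Longrightarrow> s x \<le> K * s z"
    and sg: "integrable lebesgue (\<lambda>x. s x * g x)"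
  shows "integrable lebesgue (\<lambda>x. s x * cell_avg d N g x)"
    "(LINT x|lebesgue. s x * cell_avg d N g x) \<le> K * (LINT x|lebesgue. s x * g x)"
proof -
  let ?I = "{- int N..<int N}"
  have eq: "s x * cell_avg d N g x = (\<Sum>i\<in>?I. s x * indicator (cell d i) x * cell_mean d g i)" for x
    unfolding cell_avg_def step_fun_eq_sum[OF d] sum_distrib_left by (simp only: mult_ac)
  have int: "integrable lebesgue (\<lambda>x. s x * indicator (cell d i) x)" for i
  proof (rule Bochner_Integration.integrable_bound)
    show "integrable lebesgue (\<lambda>x. indicator (cell d i) x * (K * s (of_int i * d)))"
      by (rule integrable_mult_left, rule cell_indicator_integral[OF d])
    show "(\<lambda>x. s x * indicator (cell d i) x) \<in> borel_measurable lebesgue"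
      using s(1) by (intro borel_measurable_times borel_measurable_indicator) auto
    have "of_int i * d \<in> cell d i" using d by (simp add: cell_def)
    then have "s x \<le> K * s (of_int i * d)" if "x \<in> cell d i" for x
      using K(2) cell_dist[OF that] by blast
    then show "AE x in lebesgue. norm (s x * indicator (cell d i) x)
        \<le> norm (indicator (cell d i) x * (K * s (of_int i * d)))"
      using s(2) K(1) by (intro AE_I2) (auto simp: indicator_def)
  qed
  have int': "integrable lebesgue (\<lambda>x. s x * indicator (cell d i) x * cell_mean d g i)" for i
    by (rule integrable_mult_left, rule int)
  show "integrable lebesgue (\<lambda>x. s x * cell_avg d N g x)"
    unfolding eq by (rule Bochner_Integration.integrable_sum[OF int'])
  have sgc: "set_integrable lebesgue (cell d i) (\<lambda>x. s x * g x)" for i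
    by (rule integrable_cell[OF sg])
  have one: "(LINT x|lebesgue. s x * indicator (cell d i) x * cell_mean d g i)
      \<le> K * (LINT x:cell d i|lebesgue. s x * g x)" for i
  proof -
    let ?J = "K * cell_mean d (\<lambda>x. s x * g x) i"
    have pt: "s x * cell_mean d g i \<le> ?J" if x: "x \<in> cell d i" for x
    proof -
      have "s x * cell_mean d g i = cell_mean d (\<lambda>z. s x * g z) i"
        by (rule cell_mean_linear(3)[OF g g, symmetric])
      also have "\<dots> \<le> cell_mean d (\<lambda>z. K * (s z * g z)) i"
      proof (rule cell_mean_mono_AE[OF d])
        show "AE z in lebesgue. z \<in> cell d i \<longrightarrow> s x * g z \<le> K * (s z * g z)"
          using g0
        proof eventually_elim
          case (elim z)
          show ?case
          proof
            assume "z \<in> cell d i"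
            then have "s x \<le> K * s z" using K(2) cell_dist[OF x] by blast
            then have "s x * g z \<le> K * s z * g z" using elim by (rule mult_right_mono)
            then show "s x * g z \<le> K * (s z * g z)" by (simp only: mult.assoc)
          qed
        qed
      qed (use g[of i] sgc[of i] in simp_all)
      also have "\<dots> = ?J" by (rule cell_mean_linear(3)[OF sgc sgc])
      finally show ?thesis .
    qed
    have "(LINT x|lebesgue. s x * indicator (cell d i) x * cell_mean d g i)
        \<le> (LINT x|lebesgue. indicator (cell d i) x * ?J)"
    proof (rule integral_mono[OF int'])
      show "integrable lebesgue (\<lambda>x. indicator (cell d i) x * ?J)"
        by (rule integrable_mult_left, rule cell_indicator_integral[OF d])
      show "s x * indicator (cell d i) x * cell_mean d g i \<le> indicator (cell d i) x * ?J" for x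
        using pt[of x] by (cases "x \<in> cell d i") simp_all
    qed
    also have "\<dots> = d * ?J"
      by (simp only: integral_mult_left_zero cell_indicator_integral(2)[OF d])
    also have "\<dots> = K * (LINT x:cell d i|lebesgue. s x * g x)"
      using d by (simp add: cell_mean_def)
    finally show ?thesis .
  qed
  have "(LINT x|lebesgue. s x * cell_avg d N g x)
      = (\<Sum>i\<in>?I. LINT x|lebesgue. s x * indicator (cell d i) x * cell_mean d g i)"
    unfolding eq by (rule Bochner_Integration.integral_sum[OF int'])
  also have "\<dots> \<le> (\<Sum>i\<in>?I. K * (LINT x:cell d i|lebesgue. s x * g x))"
    by (rule sum_mono[OF one])
  also have "\<dots> = K * (LINT x|lebesgue. (\<Sum>i\<in>?I. indicator (cell d i) x *\<^sub>R (s x * g x)))"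
    unfolding sum_distrib_left[symmetric] set_lebesgue_integral_def
    by (subst Bochner_Integration.integral_sum) (use sgc in \<open>auto simp: set_integrable_def\<close>)
  also have "\<dots> \<le> K * (LINT x|lebesgue. s x * g x)"
  proof (intro mult_left_mono K(1) integral_mono_AE sg)
    show "integrable lebesgue (\<lambda>x. \<Sum>i\<in>?I. indicator (cell d i) x *\<^sub>R (s x * g x))"
      using sgc by (intro Bochner_Integration.integrable_sum) (auto simp: set_integrable_def)
    show "AE x in lebesgue. (\<Sum>i\<in>?I. indicator (cell d i) x *\<^sub>R (s x * g x)) \<le> s x * g x"
      using g0
    proof eventually_elim
      case (elim x)
      have "(\<Sum>i\<in>?I. indicator (cell d i) x *\<^sub>R (s x * g x)) = step_fun d (window N (\<lambda>_. s x * g x)) x"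
        unfolding step_fun_eq_sum[OF d] by (simp add: mult.commute)
      also have "\<dots> \<le> s x * g x"
        using elim s(2)[of x] by (simp add: step_fun_def window_def)
      finally show ?case .
    qed
  qed
  finally show "(LINT x|lebesgue. s x * cell_avg d N g x) \<le> K * (LINT x|lebesgue. s x * g x)" .
qed

text \<open>By Jensen's inequality the square of the average is at most the average of the square, which
reduces the claim to the weight \<open>r\<^sup>2\<close> with the factor \<open>K\<^sup>2\<close>.\<close>

lemma cell_avg_weighted_L2:
  assumes d: "0 < d" and f: "in_L2 f"
    and r: "r \<in> borel_measurable lebesgue" "\<And>x. 0 \<le> r x"
    and K: "0 \<le> K" "\<And>x z. \<bar>x - z\<bar> \<le> d \<Longrightarrow> r x \<le> K * r z"
    and rf: "in_L2 (\<lambda>x. r x * f x)"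
  shows "in_L2 (\<lambda>x. r x * cell_avg d N f x)"
    "norm_L2 (\<lambda>x. r x * cell_avg d N f x) \<le> K * norm_L2 (\<lambda>x. r x * f x)"
proof -
  have f2: "integrable lebesgue (\<lambda>x. (f x)\<^sup>2)" using f by (simp add: in_L2_def)
  have rf2: "integrable lebesgue (\<lambda>x. (r x)\<^sup>2 * (f x)\<^sup>2)"
    using rf by (simp add: in_L2_def power_mult_distrib)
  have r2: "(r x)\<^sup>2 \<le> K\<^sup>2 * (r z)\<^sup>2" if "\<bar>x - z\<bar> \<le> d" for x z
    using power_mono[OF K(2)[OF that] r(2), of 2] by (simp add: power_mult_distrib)
  have w: "integrable lebesgue (\<lambda>x. (r x)\<^sup>2 * cell_avg d N (\<lambda>x. (f x)\<^sup>2) x)"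
    "(LINT x|lebesgue. (r x)\<^sup>2 * cell_avg d N (\<lambda>x. (f x)\<^sup>2) x) \<le> K\<^sup>2 * (LINT x|lebesgue. (r x)\<^sup>2 * (f x)\<^sup>2)"
    by (rule cell_avg_weighted[OF d integrable_cell[OF f2] _ _ _ _ r2 rf2];
        use r(1) in \<open>simp add: borel_measurable_power\<close>)+
  have pt: "(r x * cell_avg d N f x)\<^sup>2 \<le> (r x)\<^sup>2 * cell_avg d N (\<lambda>x. (f x)\<^sup>2) x" for x
    using cell_mean_square_le[OF d in_L2_cell[OF f d] integrable_cell[OF f2]]
    by (auto simp: power_mult_distrib cell_avg_def step_fun_def window_def intro!: mult_left_mono)
  have m: "(\<lambda>x. r x * cell_avg d N f x) \<in> borel_measurable lebesgue"
    by (intro borel_measurable_times r(1) cell_avg_measurable)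
  have i: "integrable lebesgue (\<lambda>x. (r x * cell_avg d N f x)\<^sup>2)"
  proof (rule Bochner_Integration.integrable_bound[OF w(1)])
    show "AE x in lebesgue. norm ((r x * cell_avg d N f x)\<^sup>2)
        \<le> norm ((r x)\<^sup>2 * cell_avg d N (\<lambda>x. (f x)\<^sup>2) x)"
      using pt by (intro AE_I2) (simp add: order_trans[OF _ abs_ge_self])
  qed (intro borel_measurable_power m)
  then show "in_L2 (\<lambda>x. r x * cell_avg d N f x)" using m by (simp add: in_L2_def)
  have "(LINT x|lebesgue. (r x * cell_avg d N f x)\<^sup>2) \<le> K\<^sup>2 * (LINT x|lebesgue. (r x * f x)\<^sup>2)"
    using integral_mono[OF i w(1) pt] w(2) by (simp add: power_mult_distrib)
  then have "norm_L2 (\<lambda>x. r x * cell_avg d N f x) \<le> sqrt (K\<^sup>2 * (LINT x|lebesgue. (r x * f x)\<^sup>2))"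
    unfolding norm_L2_def by (rule real_sqrt_le_mono)
  then show "norm_L2 (\<lambda>x. r x * cell_avg d N f x) \<le> K * norm_L2 (\<lambda>x. r x * f x)"
    using K(1) by (simp add: norm_L2_def real_sqrt_mult)
qed

lemma cell_avg_L2:
  assumes d: "0 < d" and f: "in_L2 f"
  shows "in_L2 (cell_avg d N f)" "norm_L2 (cell_avg d N f) \<le> norm_L2 f"
  using cell_avg_weighted_L2[OF d f, of "\<lambda>_. 1" 1 N] f by simp_all

section \<open>Convergence of cell averages\<close>

lemma in_L2_diff:
  assumes "in_L2 f" "in_L2 g"
  shows "in_L2 (\<lambda>x. f x - g x)"
  unfolding in_L2_def
proof
  show m: "(\<lambda>x. f x - g x) \<in> borel_measurable lebesgue"
    using assms by (auto simp: in_L2_def)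
  show "integrable lebesgue (\<lambda>x. (f x - g x)\<^sup>2)"
  proof (rule Bochner_Integration.integrable_bound)
    show "integrable lebesgue (\<lambda>x. 2 * (f x)\<^sup>2 + 2 * (g x)\<^sup>2)"
      using assms by (simp add: in_L2_def)
    have "(a - b)\<^sup>2 \<le> 2 * a\<^sup>2 + 2 * b\<^sup>2" for a b :: real
      using zero_le_power2[of "a + b"] unfolding power2_diff power2_sum by linarith
    then show "AE x in lebesgue. norm ((f x - g x)\<^sup>2) \<le> norm (2 * (f x)\<^sup>2 + 2 * (g x)\<^sup>2)"
      by (intro AE_I2) simp
  qed (intro borel_measurable_power m)
qed

lemma cell_avg_diff:
  assumes "0 < d" "in_L2 f" "in_L2 g"
  shows "cell_avg d N (\<lambda>x. f x - g x) \<xi> = cell_avg d N f \<xi> - cell_avg d N g \<xi>"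
  using cell_mean_linear(2)[OF in_L2_cell[OF assms(2,1)] in_L2_cell[OF assms(3,1)]]
  by (simp add: cell_avg_def step_fun_def window_def)

lemma compactly_supported_uniformly_continuous:
  fixes g :: "real \<Rightarrow> real"
  assumes g: "continuous_on UNIV g" and supp: "\<And>x. M < \<bar>x\<bar> \<Longrightarrow> g x = 0" and e: "0 < e"
  obtains \<delta> where "0 < \<delta>" "\<And>x z. \<bar>x - z\<bar> < \<delta> \<Longrightarrow> \<bar>g x - g z\<bar> < e"
proof -
  have "uniformly_continuous_on {-M-1..M+1} g"
    by (rule compact_uniformly_continuous[OF continuous_on_subset[OF g]]) auto
  then obtain \<delta> where \<delta>: "\<delta> > 0"
    "\<And>x z. x \<in> {-M-1..M+1} \<Longrightarrow> z \<in> {-M-1..M+1} \<Longrightarrow> dist z x < \<delta> \<Longrightarrow> dist (g z) (g x) < e"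
    using e unfolding uniformly_continuous_on_def by blast
  have "\<bar>g x - g z\<bar> < e" if "\<bar>x - z\<bar> < min \<delta> 1" for x z
  proof (cases "x \<in> {-M-1..M+1} \<and> z \<in> {-M-1..M+1}")
    case True
    then show ?thesis using \<delta>(2)[of z x] that by (auto simp: dist_real_def)
  next
    case False
    then have "M < \<bar>x\<bar> \<and> M < \<bar>z\<bar>" using that by auto
    then show ?thesis using supp e by simp
  qed
  then show ?thesis using \<delta>(1) by (intro that[of "min \<delta> 1"]) auto
qed

text \<open>A Lebesgue measurable function is an almost everywhere limit of continuous ones. Clamping these to
\<open>[-B, B]\<close> and multiplying by a cutoff that is 1 on \<open>[-n, n]\<close> provides a dominating function, so that
the limit also holds in \<open>L\<^sup>2\<close> up to the tail of \<open>f\<close> beyond \<open>n\<close>.\<close>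

lemma bounded_L2_approx_continuous:
  assumes f: "in_L2 f" and B: "AE x in lebesgue. \<bar>f x\<bar> \<le> B" and e: "0 < e"
  obtains g M where "continuous_on UNIV g" "\<And>x. M < \<bar>x\<bar> \<Longrightarrow> g x = 0" "in_L2 g"
    "(LINT x|lebesgue. (f x - g x)\<^sup>2) < e"
proof -
  have fm: "f \<in> borel_measurable lebesgue" and f2: "integrable lebesgue (\<lambda>x. (f x)\<^sup>2)"
    using f by (auto simp: in_L2_def)
  have "\<forall>\<^sub>F n in sequentially. (LINT x|lebesgue. indicator {x. real n < \<bar>x\<bar>} x * \<bar>(f x)\<^sup>2\<bar>) < e / 4"
    by (rule order_tendstoD(2)[OF tail_integral_tendsto_0[OF f2]]) (use e in simp)
  then obtain n where n: "(LINT x|lebesgue. indicator {x. real n < \<bar>x\<bar>} x * (f x)\<^sup>2) < e / 4"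
    by (auto simp: eventually_sequentially)
  define \<psi> :: "real \<Rightarrow> real" where "\<psi> x = max 0 (min 1 (real n + 1 - \<bar>x\<bar>))" for x
  define A where "A = {- (real n + 1)..real n + 1}"
  have \<psi>c: "continuous_on UNIV \<psi>" unfolding \<psi>_def by (intro continuous_intros)
  have \<psi>01: "0 \<le> \<psi> x" "\<psi> x \<le> 1" for x by (auto simp: \<psi>_def)
  have \<psi>0: "\<psi> x = 0" if "x \<notin> A" for x using that by (auto simp: \<psi>_def A_def)
  have \<psi>1: "\<psi> x = 1" if "\<bar>x\<bar> \<le> real n" for x using that by (auto simp: \<psi>_def)
  have "f measurable_on UNIV"
    by (rule lebesgue_measurable_imp_measurable_on[OF fm]) simp
  then obtain Z g where Z: "negligible Z" and gc: "\<And>k. continuous_on UNIV (g k)"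
    and glim: "\<And>x. x \<notin> Z \<Longrightarrow> (\<lambda>k. g k x) \<longlonglongrightarrow> f x"
    unfolding measurable_on_def by auto
  define G where "G k x = max (- \<bar>B\<bar>) (min \<bar>B\<bar> (g k x)) * \<psi> x" for k :: nat and x
  have Gc: "continuous_on UNIV (G k)" for k
    unfolding G_def by (intro continuous_intros gc \<psi>c)
  have Gm: "G k \<in> borel_measurable lebesgue" for k
    by (rule borel_measurable_lebesgue_continuous[OF Gc])
  have GB: "\<bar>G k x\<bar> \<le> indicator A x * \<bar>B\<bar>" for k x
  proof (cases "x \<in> A")
    case True
    have "\<bar>max (- \<bar>B\<bar>) (min \<bar>B\<bar> (g k x))\<bar> \<le> \<bar>B\<bar>" by linarith
    then have "\<bar>max (- \<bar>B\<bar>) (min \<bar>B\<bar> (g k x))\<bar> * \<psi> x \<le> \<bar>B\<bar> * 1"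
      by (rule mult_mono) (use \<psi>01 in auto)
    then show ?thesis using True \<psi>01(1)[of x] unfolding G_def abs_mult by simp
  qed (simp add: G_def \<psi>0)
  have intA: "integrable lebesgue (\<lambda>x. indicator A x * c)" for c :: real
    unfolding A_def by (rule integrable_mult_left, rule integrable_indicator_Icc)
  have GL2: "in_L2 (G k)" for k
    unfolding in_L2_def
  proof
    show "integrable lebesgue (\<lambda>x. (G k x)\<^sup>2)"
    proof (rule Bochner_Integration.integrable_bound[OF intA[of "B\<^sup>2"]])
      show "AE x in lebesgue. norm ((G k x)\<^sup>2) \<le> norm (indicator A x * B\<^sup>2)"
      proof (intro AE_I2)
        fix x show "norm ((G k x)\<^sup>2) \<le> norm (indicator A x * B\<^sup>2)"
          using power_mono[OF GB[of k x], of 2] by (cases "x \<in> A") auto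
      qed
    qed (intro borel_measurable_power Gm)
  qed (rule Gm)
  define f\<psi> where "f\<psi> x = f x * \<psi> x" for x
  have f\<psi>m: "f\<psi> \<in> borel_measurable lebesgue"
    unfolding f\<psi>_def by (intro borel_measurable_times fm borel_measurable_lebesgue_continuous \<psi>c)
  have f\<psi>L2: "in_L2 f\<psi>"
    by (rule in_L2_bound(1)[OF f\<psi>m f]) (use \<psi>01 in \<open>auto intro!: AE_I2 simp: f\<psi>_def abs_mult mult_left_le\<close>)
  have zae: "AE x in lebesgue. x \<notin> Z"
    using Z by (intro AE_not_in) (simp add: negligible_iff_null_sets)
  have "(\<lambda>k. LINT x|lebesgue. (f\<psi> x - G k x)\<^sup>2) \<longlonglongrightarrow> (LINT x::real|lebesgue. 0)"
  proof (rule integral_dominated_convergence[where w="\<lambda>x. indicator A x * (2 * \<bar>B\<bar>)\<^sup>2"])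
    show "AE x in lebesgue. (\<lambda>k. (f\<psi> x - G k x)\<^sup>2) \<longlonglongrightarrow> 0"
      using zae B
    proof eventually_elim
      case (elim x)
      have "(\<lambda>k. (f\<psi> x - G k x)\<^sup>2) \<longlonglongrightarrow> (f\<psi> x - max (- \<bar>B\<bar>) (min \<bar>B\<bar> (f x)) * \<psi> x)\<^sup>2"
        unfolding G_def by (intro tendsto_intros glim elim)
      moreover have "max (- \<bar>B\<bar>) (min \<bar>B\<bar> (f x)) = f x" using elim(2) by linarith
      ultimately show ?case by (simp add: f\<psi>_def)
    qed
    show "AE x in lebesgue. norm ((f\<psi> x - G k x)\<^sup>2) \<le> indicator A x * (2 * \<bar>B\<bar>)\<^sup>2" for k
      using B
    proof eventually_elim
      case (elim x)
      show ?case
      proof (cases "x \<in> A")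
        case True
        have "\<bar>f x\<bar> * \<psi> x \<le> \<bar>B\<bar> * 1"
          by (rule mult_mono) (use elim \<psi>01 in auto)
        then have "\<bar>f\<psi> x\<bar> \<le> \<bar>B\<bar>" using \<psi>01(1)[of x] by (simp add: f\<psi>_def abs_mult)
        then have "\<bar>f\<psi> x - G k x\<bar> \<le> 2 * \<bar>B\<bar>" using GB[of k x] True by simp
        then have "\<bar>f\<psi> x - G k x\<bar>\<^sup>2 \<le> (2 * \<bar>B\<bar>)\<^sup>2" by (rule power_mono) simp
        then show ?thesis using True by simp
      qed (simp add: f\<psi>_def G_def \<psi>0)
    qed
    show "(\<lambda>x. (f\<psi> x - G k x)\<^sup>2) \<in> borel_measurable lebesgue" for k
      by (intro borel_measurable_power borel_measurable_diff f\<psi>m Gm)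
  qed (use intA in simp_all)
  then have "(\<lambda>k. LINT x|lebesgue. (f\<psi> x - G k x)\<^sup>2) \<longlonglongrightarrow> 0" by simp
  then have "\<forall>\<^sub>F k in sequentially. (LINT x|lebesgue. (f\<psi> x - G k x)\<^sup>2) < e / 4"
    by (rule order_tendstoD(2)) (use e in simp)
  then obtain k where k: "(LINT x|lebesgue. (f\<psi> x - G k x)\<^sup>2) < e / 4"
    by (auto simp: eventually_sequentially)
  have i1: "integrable lebesgue (\<lambda>x. (f\<psi> x - G k x)\<^sup>2)"
    using in_L2_diff[OF f\<psi>L2 GL2] by (simp add: in_L2_def)
  have i2: "integrable lebesgue (\<lambda>x. indicator {x. real n < \<bar>x\<bar>} x * (f x)\<^sup>2)"
    using integrable_real_mult_indicator[OF open_Collect_abs_gt_measurable f2] by (simp add: mult.commute)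
  have "(LINT x|lebesgue. (f x - G k x)\<^sup>2)
      \<le> (LINT x|lebesgue. 2 * (indicator {x. real n < \<bar>x\<bar>} x * (f x)\<^sup>2) + 2 * (f\<psi> x - G k x)\<^sup>2)"
  proof (rule integral_mono)
    show "integrable lebesgue (\<lambda>x. (f x - G k x)\<^sup>2)"
      using in_L2_diff[OF f GL2] by (simp add: in_L2_def)
    fix x
    have sq: "(a + b)\<^sup>2 \<le> 2 * a\<^sup>2 + 2 * b\<^sup>2" for a b :: real
      using zero_le_power2[of "a - b"] unfolding power2_diff power2_sum by linarith
    have "(f x - f\<psi> x)\<^sup>2 \<le> indicator {x. real n < \<bar>x\<bar>} x * (f x)\<^sup>2"
    proof (cases "real n < \<bar>x\<bar>")
      case True
      have "f x - f\<psi> x = f x * (1 - \<psi> x)" by (simp add: f\<psi>_def algebra_simps)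
      then have "\<bar>f x - f\<psi> x\<bar> = \<bar>f x\<bar> * (1 - \<psi> x)" using \<psi>01[of x] by (simp add: abs_mult)
      also have "\<dots> \<le> \<bar>f x\<bar>" using \<psi>01[of x] by (intro mult_left_le) auto
      finally show ?thesis using True by (simp add: abs_le_square_iff)
    qed (simp add: f\<psi>_def \<psi>1)
    then show "(f x - G k x)\<^sup>2 \<le> 2 * (indicator {x. real n < \<bar>x\<bar>} x * (f x)\<^sup>2) + 2 * (f\<psi> x - G k x)\<^sup>2"
      using sq[of "f x - f\<psi> x" "f\<psi> x - G k x"] by simp
  qed (use i1 i2 in simp)
  also have "\<dots> < e" using i1 i2 n k by simp
  finally have "(LINT x|lebesgue. (f x - G k x)\<^sup>2) < e" .
  moreover have "G k x = 0" if "real n + 1 < \<bar>x\<bar>" for x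
  proof -
    have "x \<notin> A" unfolding A_def atLeastAtMost_iff using that by linarith
    then show ?thesis by (simp add: G_def \<psi>0)
  qed
  ultimately show ?thesis using that Gc GL2 by blast
qed

text \<open>The average differs from \<open>g\<close> by at most the oscillation of \<open>g\<close> on a cell. Only cells within distance
one of the support contribute, and the window contains all of these.\<close>

lemma cell_avg_continuous_close:
  assumes d: "0 < d" "d \<le> 1" and N: "M + 1 < real N * d" and M: "0 \<le> M" and e: "0 \<le> e"
    and g: "continuous_on UNIV g" "in_L2 g" and supp: "\<And>x. M < \<bar>x\<bar> \<Longrightarrow> g x = 0"
    and close: "\<And>x z. \<bar>x - z\<bar> \<le> d \<Longrightarrow> \<bar>g x - g z\<bar> \<le> e"
  shows "(LINT x|lebesgue. (cell_avg d N g x - g x)\<^sup>2) \<le> e\<^sup>2 * (2 * M + 2)"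
proof -
  let ?A = "{-(M + 1)..M + 1}"
  have pt: "\<bar>cell_avg d N g x - g x\<bar> \<le> indicator ?A x * e" for x
  proof -
    let ?i = "\<lfloor>x / d\<rfloor>"
    have own: "x \<in> cell d ?i" by (rule mem_own_cell[OF d(1)])
    have si: "set_integrable lebesgue (cell d ?i) g" by (rule in_L2_cell[OF g(2) d(1)])
    have win: "cell_avg d N g x = cell_mean d g ?i" if "\<bar>x\<bar> < real N * d"
      using window_iff[OF d(1), of N x] that by (auto simp: cell_avg_def step_fun_def window_def)
    show ?thesis
    proof (cases "x \<in> ?A")
      case True
      have "cell_mean d g ?i \<le> g x + e"
        by (rule cell_mean_bounds(1)[OF d(1) si], rule AE_I2)
          (use close[of _ x] cell_dist[OF _ own] in force)
      moreover have "g x - e \<le> cell_mean d g ?i"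
        by (rule cell_mean_bounds(2)[OF d(1) si], rule AE_I2)
          (use close[of _ x] cell_dist[OF _ own] in force)
      ultimately show ?thesis using True win N by auto
    next
      case False
      have z: "g z = 0" if "z \<in> cell d ?i" for z
        using supp[of z] cell_dist[OF that own] d False by auto
      have "cell_mean d g ?i \<le> 0" "0 \<le> cell_mean d g ?i"
        by (rule cell_mean_bounds[OF d(1) si], rule AE_I2, simp add: z)+
      then have "cell_avg d N g x = 0" by (auto simp: cell_avg_def step_fun_def window_def)
      then show ?thesis using z[OF own] False by simp
    qed
  qed
  have iA: "integrable lebesgue (\<lambda>x. indicator ?A x * e\<^sup>2)"
    by (rule integrable_mult_left, rule integrable_indicator_Icc)
  have "(LINT x|lebesgue. (cell_avg d N g x - g x)\<^sup>2) \<le> (LINT x|lebesgue. indicator ?A x * e\<^sup>2)"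
  proof (rule integral_mono[OF _ iA])
    show "integrable lebesgue (\<lambda>x. (cell_avg d N g x - g x)\<^sup>2)"
      using in_L2_diff[OF cell_avg_L2(1)[OF d(1) g(2)] g(2)] by (simp add: in_L2_def)
    fix x show "(cell_avg d N g x - g x)\<^sup>2 \<le> indicator ?A x * e\<^sup>2"
      using power_mono[OF pt[of x], of 2] by (cases "x \<in> ?A") auto
  qed
  also have "\<dots> = e\<^sup>2 * (2 * M + 2)" using M by simp
  finally show ?thesis .
qed

text \<open>Density: averaging is a contraction of \<open>L\<^sup>2\<close>, uniformly in the grid, so convergence for continuous
functions of compact support extends to their limits.\<close>

lemma cell_avg_tendsto_L2:
  fixes d :: "nat \<Rightarrow> real" and N :: "nat \<Rightarrow> nat"
  assumes d: "\<And>n. 1 \<le> n \<Longrightarrow> 0 < d n" "\<And>n. 1 \<le> n \<Longrightarrow> d n \<le> 1 / real n"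
    and N: "\<And>n. 1 \<le> n \<Longrightarrow> real n \<le> real (N n) * d n"
    and f: "in_L2 f" and B: "AE x in lebesgue. \<bar>f x\<bar> \<le> B"
  shows "(\<lambda>n. norm_L2 (\<lambda>x. cell_avg (d n) (N n) f x - f x)) \<longlonglongrightarrow> 0"
proof -
  have "(\<lambda>n. LINT x|lebesgue. (cell_avg (d n) (N n) f x - f x)\<^sup>2) \<longlonglongrightarrow> 0"
  proof (rule LIMSEQ_I)
    fix r :: real assume r: "0 < r"
    obtain g M where g: "continuous_on UNIV g" "in_L2 g" and supp': "\<And>x. M < \<bar>x\<bar> \<Longrightarrow> g x = 0"
      and fg: "(LINT x|lebesgue. (f x - g x)\<^sup>2) < r / 12"
      by (rule bounded_L2_approx_continuous[OF f B, of "r / 12"]) (use r in auto)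
    define M' where "M' = max 0 M"
    have M': "0 \<le> M'" and supp: "\<And>x. M' < \<bar>x\<bar> \<Longrightarrow> g x = 0" using supp' by (auto simp: M'_def)
    \<comment> \<open>the error is split into three parts, each at most \<open>r / 12\<close>, and by
      \<open>(a + b - c)\<^sup>2 \<le> 3 (a\<^sup>2 + b\<^sup>2 + c\<^sup>2)\<close> each of them counts three times\<close>
    define e where "e = sqrt (r / (12 * (2 * M' + 2)))"
    have e0: "0 < e" using r M' by (simp add: e_def)
    have e2: "e\<^sup>2 * (2 * M' + 2) = r / 12"
      using r M' by (simp add: e_def field_simps)
    obtain \<delta> where \<delta>: "0 < \<delta>" "\<And>x z. \<bar>x - z\<bar> < \<delta> \<Longrightarrow> \<bar>g x - g z\<bar> < e"
      using compactly_supported_uniformly_continuous[OF g(1) supp e0] by blast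
    obtain n0 :: nat where n0: "max (1 / \<delta>) (M' + 1) < real n0"
      using reals_Archimedean2 by blast
    show "\<exists>no. \<forall>n\<ge>no. norm ((LINT x|lebesgue. (cell_avg (d n) (N n) f x - f x)\<^sup>2) - 0) < r"
    proof (intro exI allI impI)
      fix n assume n: "n0 \<le> n"
      let ?P = "cell_avg (d n) (N n)"
      have n1: "1 \<le> n" using n0 n M' by (auto simp: Suc_le_eq intro!: Nat.gr0I)
      have d0: "0 < d n" by (rule d(1)[OF n1])
      have "1 / \<delta> < real n" using n0 n by linarith
      then have "1 / real n < \<delta>" using \<delta>(1) n1 by (simp add: field_simps)
      then have dn: "d n < \<delta>" using d(2)[OF n1] by linarith
      have "1 / real n \<le> 1" using n1 by simp
      then have dn1: "d n \<le> 1" using d(2)[OF n1] by linarith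
      have Nn: "M' + 1 < real (N n) * d n" using N[OF n1] n0 n by linarith
      have c1: "(LINT x|lebesgue. (?P g x - g x)\<^sup>2) \<le> r / 12"
        unfolding e2[symmetric]
      proof (rule cell_avg_continuous_close[OF d0 dn1 Nn M' _ g supp])
        show "\<bar>g x - g z\<bar> \<le> e" if "\<bar>x - z\<bar> \<le> d n" for x z
          using \<delta>(2)[of x z] that dn by linarith
      qed (use e0 in auto)
      have fgL2: "in_L2 (\<lambda>x. f x - g x)" by (rule in_L2_diff[OF f g(2)])
      have "sqrt (LINT x|lebesgue. (?P (\<lambda>x. f x - g x) x)\<^sup>2) \<le> sqrt (LINT x|lebesgue. (f x - g x)\<^sup>2)"
        using cell_avg_L2(2)[OF d0 fgL2, of "N n"] by (simp add: norm_L2_def)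
      then have c2: "(LINT x|lebesgue. (?P (\<lambda>x. f x - g x) x)\<^sup>2) < r / 12"
        using fg by simp
      have i: "integrable lebesgue (\<lambda>x. (?P f x - f x)\<^sup>2)" "integrable lebesgue (\<lambda>x. (?P g x - g x)\<^sup>2)"
        "integrable lebesgue (\<lambda>x. (f x - g x)\<^sup>2)" "integrable lebesgue (\<lambda>x. (?P (\<lambda>x. f x - g x) x)\<^sup>2)"
        using in_L2_diff[OF cell_avg_L2(1)[OF d0 f, of "N n"] f] in_L2_diff[OF cell_avg_L2(1)[OF d0 g(2), of "N n"] g(2)]
          fgL2 cell_avg_L2(1)[OF d0 fgL2, of "N n"] by (simp_all add: in_L2_def)
      have "(LINT x|lebesgue. (?P f x - f x)\<^sup>2) \<le> (LINT x|lebesgue.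
          3 * (?P (\<lambda>x. f x - g x) x)\<^sup>2 + 3 * (?P g x - g x)\<^sup>2 + 3 * (f x - g x)\<^sup>2)"
      proof (rule integral_mono[OF i(1)])
        fix x
        have sq: "(a + b - c)\<^sup>2 \<le> 3 * a\<^sup>2 + 3 * b\<^sup>2 + 3 * c\<^sup>2" for a b c :: real
          using zero_le_power2[of "a - b"] zero_le_power2[of "a + c"] zero_le_power2[of "b + c"]
          by (simp add: power2_eq_square algebra_simps)
        show "(?P f x - f x)\<^sup>2 \<le> 3 * (?P (\<lambda>x. f x - g x) x)\<^sup>2 + 3 * (?P g x - g x)\<^sup>2 + 3 * (f x - g x)\<^sup>2"
          using sq[of "?P f x - ?P g x" "?P g x - g x" "f x - g x"]
          by (simp add: cell_avg_diff[OF d0 f g(2)])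
      qed (use i in simp)
      also have "\<dots> = 3 * (LINT x|lebesgue. (?P (\<lambda>x. f x - g x) x)\<^sup>2)
          + 3 * (LINT x|lebesgue. (?P g x - g x)\<^sup>2) + 3 * (LINT x|lebesgue. (f x - g x)\<^sup>2)"
        using i by simp
      also have "\<dots> < r" using c1 c2 fg r by linarith
      finally have "(LINT x|lebesgue. (?P f x - f x)\<^sup>2) < r" .
      moreover have "0 \<le> (LINT x|lebesgue. (?P f x - f x)\<^sup>2)"
        by (rule Bochner_Integration.integral_nonneg) simp
      ultimately show "norm ((LINT x|lebesgue. (?P f x - f x)\<^sup>2) - 0) < r" by simp
    qed
  qed
  from tendsto_real_sqrt[OF this] show ?thesis by (simp add: norm_L2_def)
qed

section \<open>The discretized element\<close>

text \<open>The value of \<open>U\<close> on a cell must be small enough for the inequality \<open>q h \<ge> U\<^sup>2 q\<^sup>2 + w\<^sup>2\<close> to survive averaging.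
The value of least modulus on the closed cell is small enough, is still close to \<open>U\<close>, and is
dominated by \<open>\<bar>U\<bar>\<close> pointwise.\<close>

definition min_point :: "real \<Rightarrow> (real \<Rightarrow> real) \<Rightarrow> int \<Rightarrow> real" where
  "min_point d f i = (SOME x. x \<in> {of_int i * d..of_int (i + 1) * d} \<and>
     (\<forall>z\<in>{of_int i * d..of_int (i + 1) * d}. \<bar>f x\<bar> \<le> \<bar>f z\<bar>))"

text \<open>The derivatives \<open>h\<close> and \<open>w\<close> are averaged over the cells in \<open>[-N d, N d)\<close> and \<open>H\<close> is sampled at the left end
of each cell; \<open>v = -h\<close> makes \<open>q + h = 1\<close> hold everywhere, and \<open>\<zeta> = -H\<close> holds already for \<open>Y\<close>.
Truncating the index at \<open>N\<close> makes \<open>H\<close> constant on the right.\<close>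

definition grid_lagr :: "real \<Rightarrow> nat \<Rightarrow> lagr \<Rightarrow> lagr" where
  "grid_lagr d N Y = (let Hs = step_fun d (\<lambda>i. if i < - int N then 0 else HL Y (of_int (min i (int N)) * d)) in
     Lagr (\<lambda>\<xi>. - Hs \<xi>) (step_fun d (window N (\<lambda>i. UL Y (min_point d (UL Y) i)))) Hs
       (\<lambda>\<xi>. - cell_avg d N (hL Y) \<xi>) (cell_avg d N (wL Y)) (cell_avg d N (hL Y)))"

lemma grid_lagr_simps:
  "HL (grid_lagr d N Y) = step_fun d (\<lambda>i. if i < - int N then 0 else HL Y (of_int (min i (int N)) * d))"
  "zetaL (grid_lagr d N Y) = (\<lambda>\<xi>. - HL (grid_lagr d N Y) \<xi>)"
  "UL (grid_lagr d N Y) = step_fun d (window N (\<lambda>i. UL Y (min_point d (UL Y) i)))"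
  "hL (grid_lagr d N Y) = cell_avg d N (hL Y)"
  "vL (grid_lagr d N Y) = (\<lambda>\<xi>. - hL (grid_lagr d N Y) \<xi>)"
  "wL (grid_lagr d N Y) = cell_avg d N (wL Y)"
  "qL (grid_lagr d N Y) = (\<lambda>\<xi>. 1 - hL (grid_lagr d N Y) \<xi>)"
  by (simp_all add: grid_lagr_def Let_def qL_def fun_eq_iff)

lemma measurable_grid_lagr:
  "zetaL (grid_lagr d N Y) \<in> borel_measurable lebesgue" "UL (grid_lagr d N Y) \<in> borel_measurable lebesgue"
  "HL (grid_lagr d N Y) \<in> borel_measurable lebesgue" "vL (grid_lagr d N Y) \<in> borel_measurable lebesgue"
  "wL (grid_lagr d N Y) \<in> borel_measurable lebesgue" "hL (grid_lagr d N Y) \<in> borel_measurable lebesgue"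
  unfolding grid_lagr_simps
  by (intro borel_measurable_uminus step_fun_measurable cell_avg_measurable)+

lemma min_point:
  assumes d: "0 < d" and f: "continuous_on UNIV f"
  shows "min_point d f i \<in> {of_int i * d..of_int (i + 1) * d}"
    "z \<in> {of_int i * d..of_int (i + 1) * d} \<Longrightarrow> \<bar>f (min_point d f i)\<bar> \<le> \<bar>f z\<bar>"
proof -
  have "\<exists>x\<in>{of_int i * d..of_int (i + 1) * d}. \<forall>z\<in>{of_int i * d..of_int (i + 1) * d}. \<bar>f x\<bar> \<le> \<bar>f z\<bar>"
    using d by (intro continuous_attains_inf continuous_intros continuous_on_subset[OF f])
      (auto simp: algebra_simps)
  then have "\<exists>x. x \<in> {of_int i * d..of_int (i + 1) * d} \<and>
     (\<forall>z\<in>{of_int i * d..of_int (i + 1) * d}. \<bar>f x\<bar> \<le> \<bar>f z\<bar>)" by blast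
  from someI_ex[OF this]
  show "min_point d f i \<in> {of_int i * d..of_int (i + 1) * d}"
    "z \<in> {of_int i * d..of_int (i + 1) * d} \<Longrightarrow> \<bar>f (min_point d f i)\<bar> \<le> \<bar>f z\<bar>"
    unfolding min_point_def by blast+
qed

text \<open>The discriminant of a quadratic polynomial that is nonnegative on the real line, including the
degenerate case of leading coefficient 0.\<close>

lemma discriminant_le:
  fixes Q W G :: real
  assumes p: "\<And>t. 0 \<le> t\<^sup>2 * Q + 2 * t * W + G" and Q: "0 \<le> Q"
  shows "W\<^sup>2 \<le> Q * G"
proof (cases "Q = 0")
  case True
  have "W = 0"
  proof (rule ccontr)
    assume "W \<noteq> 0"
    then have "2 * (- (G + 1) / (2 * W)) * W = - (G + 1)" by (simp add: field_simps)
    with p[of "- (G + 1) / (2 * W)"] True have "0 \<le> - (G + 1) + G"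
      by (simp only: mult_zero_right add_0)
    then show False by simp
  qed
  then show ?thesis using True by simp
next
  case False
  have "0 \<le> Q * ((- W / Q)\<^sup>2 * Q + 2 * (- W / Q) * W + G)"
    using Q by (intro mult_nonneg_nonneg p)
  also have "\<dots> = Q * G - W\<^sup>2"
    using False by (simp add: field_simps power2_eq_square)
  finally show ?thesis by simp
qed

text \<open>With \<open>q = 1 - h\<close>, the relation gives \<open>w\<^sup>2 \<le> q (h - m q)\<close> with \<open>q \<ge> 0\<close> and \<open>h - m q \<ge> 0\<close>. In other words
\<open>t\<^sup>2 q + 2 t w + (h - m q) \<ge> 0\<close> for all \<open>t\<close>. This condition is linear in \<open>(q, w, h)\<close>, so it passes to the means, and
the discriminant turns it back into the quadratic inequality.\<close>

lemma cell_mean_inequality: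
  assumes d: "0 < d" and w: "in_L2 w" and h: "in_L2 h" and m: "\<And>x. x \<in> cell d i \<Longrightarrow> m \<le> (U x)\<^sup>2"
    and rel: "AE x in lebesgue. 0 \<le> h x \<and> h x \<le> 1 \<and> (1 - h x) * h x = (U x)\<^sup>2 * (1 - h x)\<^sup>2 + (w x)\<^sup>2"
  shows "m * (1 - cell_mean d h i)\<^sup>2 + (cell_mean d w i)\<^sup>2 \<le> (1 - cell_mean d h i) * cell_mean d h i"
proof -
  let ?H = "cell_mean d h i" and ?W = "cell_mean d w i"
  have si: "set_integrable lebesgue (cell d i) w" "set_integrable lebesgue (cell d i) h"
    by (rule in_L2_cell[OF w d], rule in_L2_cell[OF h d])
  have "?W\<^sup>2 \<le> (1 - ?H) * (?H - m * (1 - ?H))"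
  proof (rule discriminant_le)
    have "AE x in lebesgue. x \<in> cell d i \<longrightarrow> h x \<le> 1"
      using rel by eventually_elim simp
    then show "0 \<le> 1 - ?H" using cell_mean_bounds(1)[OF d si(2)] by simp
    fix t :: real
    \<comment> \<open>the quadratic polynomial in \<open>t\<close>, written as \<open>a h + 2 t w + b\<close> after substituting \<open>q = 1 - h\<close>\<close>
    define a b where "a = 1 + m - t\<^sup>2" and "b = t\<^sup>2 - m"
    have ah: "set_integrable lebesgue (cell d i) (\<lambda>x. a * h x)"
      and tw: "set_integrable lebesgue (cell d i) (\<lambda>x. 2 * t * w x)"
      using si by simp_all
    have s: "set_integrable lebesgue (cell d i) (\<lambda>x. a * h x + 2 * t * w x)"
      by (intro set_integral_add ah tw)
    have "0 \<le> cell_mean d (\<lambda>x. (a * h x + 2 * t * w x) + b) i"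
    proof (rule cell_mean_bounds(2)[OF d])
      show "set_integrable lebesgue (cell d i) (\<lambda>x. a * h x + 2 * t * w x + b)"
        by (intro set_integral_add s const_cell d)
      show "AE x in lebesgue. x \<in> cell d i \<longrightarrow> 0 \<le> a * h x + 2 * t * w x + b"
        using rel
      proof eventually_elim
        case (elim x)
        show ?case
        proof
          assume x: "x \<in> cell d i"
          define q where "q = 1 - h x"
          have q: "0 \<le> q" "h x = 1 - q" "q * h x = (U x)\<^sup>2 * q\<^sup>2 + (w x)\<^sup>2"
            using elim by (auto simp: q_def)
          have eq: "a * h x + 2 * t * w x + b = t\<^sup>2 * q + 2 * t * w x + (h x - m * q)"
            by (simp add: a_def b_def q_def algebra_simps)
          show "0 \<le> a * h x + 2 * t * w x + b"
          proof (cases "q = 0")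
            case True
            then show ?thesis using q elim unfolding eq by simp
          next
            case False
            have "m * q\<^sup>2 \<le> (U x)\<^sup>2 * q\<^sup>2" by (intro mult_right_mono m x) simp
            then have "0 \<le> (t * q + w x)\<^sup>2 + (q * h x - m * q\<^sup>2 - (w x)\<^sup>2)"
              using q(3) by simp
            also have "\<dots> = q * (t\<^sup>2 * q + 2 * t * w x + (h x - m * q))"
              by (simp add: power2_eq_square algebra_simps)
            finally show ?thesis
              using False q(1) unfolding eq by (simp add: zero_le_mult_iff)
          qed
        qed
      qed
    qed
    also have "\<dots> = a * ?H + 2 * t * ?W + b"
      by (simp only: cell_mean_linear(1)[OF s const_cell[OF d]] cell_mean_linear(1)[OF ah tw]
          cell_mean_linear(3)[OF si(1) si(1)] cell_mean_linear(3)[OF si(2) si(2)] cell_mean_const[OF d])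
    also have "\<dots> = t\<^sup>2 * (1 - ?H) + 2 * t * ?W + (?H - m * (1 - ?H))"
      by (simp add: a_def b_def algebra_simps)
    finally show "0 \<le> t\<^sup>2 * (1 - ?H) + 2 * t * ?W + (?H - m * (1 - ?H))" .
  qed
  then show ?thesis by (simp add: power2_eq_square algebra_simps)
qed

text \<open>What the discretization uses of the Lagrangian element; the function \<open>u\<close> no longer occurs.\<close>

locale normalized_lagr =
  fixes Y :: lagr
  assumes H_mono: "\<And>x z. x \<le> z \<Longrightarrow> HL Y x \<le> HL Y z"
    and H_lipschitz: "\<And>x z. x \<le> z \<Longrightarrow> HL Y z - HL Y x \<le> z - x"
    and H_nonneg: "\<And>x. 0 \<le> HL Y x"
    and H_bounded: "\<exists>B. \<forall>x. HL Y x \<le> B"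
    and H_at_bot: "(HL Y \<longlongrightarrow> 0) at_bot"
    and zeta_eq: "\<And>x. zetaL Y x = - HL Y x"
    and U_lipschitz: "\<And>x z. x \<le> z \<Longrightarrow> \<bar>UL Y z - UL Y x\<bar> \<le> z - x"
    and energy: "AE \<xi> in lebesgue. qL Y \<xi> + hL Y \<xi> = 1 \<and> 0 \<le> qL Y \<xi> \<and> 0 \<le> hL Y \<xi> \<and>
      qL Y \<xi> * hL Y \<xi> = (UL Y \<xi>)\<^sup>2 * (qL Y \<xi>)\<^sup>2 + (wL Y \<xi>)\<^sup>2"
    and in_F: "Y \<in> F_space"
begin

lemma H_continuous: "continuous_on UNIV (HL Y)"
proof (rule lipschitz_imp_continuous)
  fix x z :: real assume "x \<le> z"
  then show "\<bar>HL Y z - HL Y x\<bar> \<le> z - x" using H_mono[of x z] H_lipschitz[of x z] by linarith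
qed

lemma U_continuous: "continuous_on UNIV (UL Y)"
  by (rule lipschitz_imp_continuous[OF U_lipschitz])

lemma in_F_parts: "in_Linf (zetaL Y)" "in_Linf (UL Y)" "in_L2 (UL Y)" "in_Linf (HL Y)"
  "in_L2 (vL Y)" "in_L2 (wL Y)" "in_L2 (hL Y)"
  using in_F by (auto simp: F_space_def)

lemma relation_h:
  "AE \<xi> in lebesgue. 0 \<le> hL Y \<xi> \<and> hL Y \<xi> \<le> 1 \<and>
    (1 - hL Y \<xi>) * hL Y \<xi> = (UL Y \<xi>)\<^sup>2 * (1 - hL Y \<xi>)\<^sup>2 + (wL Y \<xi>)\<^sup>2"
  using energy
proof eventually_elim
  case (elim \<xi>)
  then have "qL Y \<xi> = 1 - hL Y \<xi>" by linarith
  with elim show ?case by auto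
qed

lemma h_bound: "AE \<xi> in lebesgue. \<bar>hL Y \<xi>\<bar> \<le> 1"
  using relation_h by eventually_elim auto

lemma h_nonneg: "AE \<xi> in lebesgue. 0 \<le> hL Y \<xi>"
  using relation_h by eventually_elim auto

lemma w_bound: "AE \<xi> in lebesgue. \<bar>wL Y \<xi>\<bar> \<le> 1"
  using relation_h
proof eventually_elim
  case (elim \<xi>)
  have "0 \<le> (UL Y \<xi>)\<^sup>2 * (1 - hL Y \<xi>)\<^sup>2" by simp
  then have "(wL Y \<xi>)\<^sup>2 \<le> (1 - hL Y \<xi>) * hL Y \<xi>" using elim by linarith
  also have "\<dots> \<le> 1 * 1" using elim by (intro mult_mono) auto
  finally show ?case by (simp add: abs_square_le_1)
qed

lemma v_eq: "AE \<xi> in lebesgue. vL Y \<xi> = - hL Y \<xi>"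
  using energy by eventually_elim (auto simp: qL_def)

context
  fixes d :: real and N :: nat
  assumes d: "0 < d"
begin

abbreviation "Z \<equiv> grid_lagr d N Y"

lemma hZ_bounds: "0 \<le> hL Z \<xi>" "hL Z \<xi> \<le> 1"
proof -
  have "AE x in lebesgue. x \<in> cell d i \<longrightarrow> 0 \<le> hL Y x" for i
    using h_nonneg by eventually_elim simp
  then have "0 \<le> cell_mean d (hL Y) i" for i
    using cell_mean_bounds(2)[OF d in_L2_cell[OF in_F_parts(7) d]] by blast
  then show "0 \<le> hL Z \<xi>"
    by (simp add: grid_lagr_simps cell_avg_def step_fun_def window_def)
  show "hL Z \<xi> \<le> 1"
    using cell_avg_bound[OF d in_L2_cell[OF in_F_parts(7) d] h_bound, of N \<xi>]
    by (simp add: grid_lagr_simps)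
qed

lemma cell_subset_Icc: "\<xi> \<in> {of_int \<lfloor>\<xi> / d\<rfloor> * d..of_int (\<lfloor>\<xi> / d\<rfloor> + 1) * d}"
  using mem_own_cell[OF d, of \<xi>] unfolding cell_def by simp

lemma UZ_le: "\<bar>UL Z \<xi>\<bar> \<le> \<bar>UL Y \<xi>\<bar>"
  using min_point(2)[OF d U_continuous cell_subset_Icc]
  by (simp add: grid_lagr_simps step_fun_def window_def)

lemma HZ_le: "\<bar>HL Z \<xi>\<bar> \<le> norm_Linf (HL Y)"
  using continuous_abs_le_norm_Linf[OF H_continuous in_F_parts(4)] norm_Linf_nonneg
  by (simp add: grid_lagr_simps step_fun_def)

text \<open>Inside the window this is the inequality for the means, with \<open>m\<close> the least value of \<open>U\<^sup>2\<close> on the cell.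
Outside the window \<open>h\<close>, \<open>U\<close> and \<open>w\<close> all vanish.\<close>

lemma relation_Z:
  "(UL Z \<xi>)\<^sup>2 * (qL Z \<xi>)\<^sup>2 + (wL Z \<xi>)\<^sup>2 \<le> qL Z \<xi> * hL Z \<xi>"
proof -
  let ?i = "\<lfloor>\<xi> / d\<rfloor>"
  have m: "(UL Y (min_point d (UL Y) ?i))\<^sup>2 \<le> (UL Y x)\<^sup>2" if "x \<in> cell d ?i" for x
    using min_point(2)[OF d U_continuous, of x ?i] that
    unfolding abs_le_square_iff[symmetric] cell_def by auto
  have "(UL Y (min_point d (UL Y) ?i))\<^sup>2 * (1 - cell_mean d (hL Y) ?i)\<^sup>2 + (cell_mean d (wL Y) ?i)\<^sup>2
      \<le> (1 - cell_mean d (hL Y) ?i) * cell_mean d (hL Y) ?i"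
    by (rule cell_mean_inequality[OF d in_F_parts(6,7) m relation_h])
  then show ?thesis
    by (auto simp: grid_lagr_simps cell_avg_def step_fun_def window_def)
qed

lemma zetaZ_norm: "in_Linf (zetaL Z)" "norm_Linf (zetaL Z) \<le> norm_Linf (zetaL Y)"
proof -
  have z: "continuous_on UNIV (zetaL Y)"
    by (rule continuous_on_eq[OF continuous_on_minus[OF H_continuous]]) (simp add: zeta_eq)
  have "\<bar>HL Y x\<bar> \<le> norm_Linf (zetaL Y)" for x
    using continuous_abs_le_norm_Linf[OF z in_F_parts(1), of x] by (simp add: zeta_eq)
  then have "\<bar>zetaL Z \<xi>\<bar> \<le> norm_Linf (zetaL Y)" for \<xi>
    using norm_Linf_nonneg by (simp add: grid_lagr_simps step_fun_def)
  then have ae: "AE \<xi> in lebesgue. \<bar>zetaL Z \<xi>\<bar> \<le> norm_Linf (zetaL Y)" by (intro AE_I2)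
  show "in_Linf (zetaL Z)" "norm_Linf (zetaL Z) \<le> norm_Linf (zetaL Y)"
    by (rule in_LinfI[OF measurable_grid_lagr(1) ae], rule norm_Linf_le[OF measurable_grid_lagr(1) ae])
qed

lemma UZ_norm: "in_Linf (UL Z)" "norm_Linf (UL Z) \<le> norm_Linf (UL Y)"
  "in_L2 (UL Z)" "norm_L2 (UL Z) \<le> norm_L2 (UL Y)"
proof -
  have ae: "AE \<xi> in lebesgue. \<bar>UL Z \<xi>\<bar> \<le> norm_Linf (UL Y)"
    using AE_abs_le_norm_Linf[OF in_F_parts(2)]
    by eventually_elim (rule order_trans[OF UZ_le])
  show "in_Linf (UL Z)" "norm_Linf (UL Z) \<le> norm_Linf (UL Y)"
    by (rule in_LinfI[OF measurable_grid_lagr(2) ae], rule norm_Linf_le[OF measurable_grid_lagr(2) ae])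
  show "in_L2 (UL Z)" "norm_L2 (UL Z) \<le> norm_L2 (UL Y)"
    by (rule in_L2_bound[OF measurable_grid_lagr(2) in_F_parts(3)], simp add: UZ_le)+
qed

lemma HZ_norm: "in_Linf (HL Z)" "norm_Linf (HL Z) \<le> norm_Linf (HL Y)"
  by (rule in_LinfI[OF measurable_grid_lagr(3)] norm_Linf_le[OF measurable_grid_lagr(3)], rule AE_I2, rule HZ_le)+

lemma hZ_norm: "in_L2 (hL Z)" "norm_L2 (hL Z) \<le> norm_L2 (hL Y)"
  and wZ_norm: "in_L2 (wL Z)" "norm_L2 (wL Z) \<le> norm_L2 (wL Y)"
  unfolding grid_lagr_simps by (intro cell_avg_L2 d in_F_parts)+

lemma vZ_norm: "in_L2 (vL Z)" "norm_L2 (vL Z) \<le> norm_L2 (vL Y)"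
proof -
  have hm: "hL Y \<in> borel_measurable lebesgue" using in_F_parts(7) by (simp add: in_L2_def)
  have "AE \<xi> in lebesgue. \<bar>hL Y \<xi>\<bar> \<le> \<bar>vL Y \<xi>\<bar>"
    using v_eq by eventually_elim simp
  from in_L2_bound(2)[OF hm in_F_parts(5) this]
  have "norm_L2 (hL Z) \<le> norm_L2 (vL Y)" using hZ_norm(2) by linarith
  moreover have "norm_L2 (vL Z) \<le> norm_L2 (hL Z)" "in_L2 (vL Z)"
    by (rule in_L2_bound[OF measurable_grid_lagr(4) hZ_norm(1)], simp add: grid_lagr_simps)+
  ultimately show "in_L2 (vL Z)" "norm_L2 (vL Z) \<le> norm_L2 (vL Y)" by simp_all
qed

lemma Z_in_F: "Z \<in> F_space"
  unfolding F_space_def using zetaZ_norm UZ_norm HZ_norm vZ_norm wZ_norm hZ_norm by simp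

lemma norm_F_Z: "norm_F Z \<le> norm_F Y"
  unfolding norm_F_def by (intro add_mono zetaZ_norm UZ_norm HZ_norm vZ_norm wZ_norm hZ_norm)

lemma Z_in_grid: "Z \<in> F_grid d (real N * d)"
proof -
  have gc: "grid_const d (step_fun d F)" for F by (rule grid_const_step_fun[OF d])
  have gm: "grid_const d (\<lambda>x. - f x)" if "grid_const d f" for f
    using that by (simp add: grid_const_def)
  have out: "UL Z \<xi> = 0 \<and> vL Z \<xi> = 0 \<and> wL Z \<xi> = 0 \<and> hL Z \<xi> = 0"
    if "\<xi> \<in> {..<-(real N * d)} \<union> {real N * d..}" for \<xi>
    using window_step_fun_outside[OF d that] by (simp add: grid_lagr_simps cell_avg_def)
  have R: "HL Z \<xi> = HL Y (real N * d)" if "\<xi> \<in> {real N * d..}" for \<xi>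
  proof -
    have "int N \<le> \<lfloor>\<xi> / d\<rfloor>" using that d by (simp add: le_floor_iff pos_le_divide_eq)
    then show ?thesis by (simp add: grid_lagr_simps step_fun_def min_def)
  qed
  have L: "HL Z \<xi> = 0" if "\<xi> \<in> {..<-(real N * d)}" for \<xi>
  proof -
    have "\<lfloor>\<xi> / d\<rfloor> < - int N" using that d by (simp add: floor_less_iff pos_divide_less_eq)
    then show ?thesis by (simp add: grid_lagr_simps step_fun_def)
  qed
  have "\<exists>a. \<forall>\<xi>\<in>{real N * d..}. zetaL Z \<xi> = a" "\<exists>a. \<forall>\<xi>\<in>{real N * d..}. HL Z \<xi> = a"
    "\<exists>a. \<forall>\<xi>\<in>{..<-(real N * d)}. zetaL Z \<xi> = a"
    unfolding grid_lagr_simps(2) using R L by auto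
  moreover have "grid_const d (HL Z)" "grid_const d (UL Z)" "grid_const d (hL Z)" "grid_const d (wL Z)"
    unfolding grid_lagr_simps cell_avg_def by (rule gc)+
  moreover then have "grid_const d (zetaL Z)" "grid_const d (vL Z)"
    unfolding grid_lagr_simps(2,5) by (auto intro: gm)
  ultimately show ?thesis
    unfolding F_grid_def using Z_in_F out L by blast
qed

text \<open>Each part of the norm is controlled by the same part for \<open>Y\<close>, up to the factor \<open>K\<close> for the averaged
weighted components. The exception is \<open>q\<close>, which the truncation sets to 1 outside the window: its
norm is at most \<open>1 \<le> \<parallel>q\<parallel> + \<parallel>h\<parallel>\<close>, because \<open>q + h = 1\<close>, so the norm of \<open>h\<close> is used twice.\<close>

lemma Z_weighted:
  assumes Y: "Y \<in> F_weighted r s"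
    and r: "r \<in> borel_measurable lebesgue" "\<And>x. 0 \<le> r x" "\<And>x z. \<bar>x - z\<bar> \<le> d \<Longrightarrow> r x \<le> K * r z"
    and s: "s \<in> borel_measurable lebesgue" "\<And>x. 0 \<le> s x" "\<And>x z. \<bar>x - z\<bar> \<le> d \<Longrightarrow> s x \<le> K * s z"
    and K: "0 \<le> K"
  shows "Z \<in> F_weighted r s \<and> norm_F_weighted r s Z \<le> (2 + K) * norm_F_weighted r s Y"
proof -
  have q: "in_Linf (qL Y)" and w: "in_Linf (wL Y)" and h: "in_Linf (hL Y)"
    and rU: "in_L2 (\<lambda>\<xi>. r \<xi> * UL Y \<xi>)" and rw: "in_L2 (\<lambda>\<xi>. r \<xi> * wL Y \<xi>)"
    and sh: "integrable lebesgue (\<lambda>\<xi>. s \<xi> * hL Y \<xi>)"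
    using Y by (auto simp: F_weighted_def in_L1_def)
  have wZ: "AE \<xi> in lebesgue. \<bar>wL Z \<xi>\<bar> \<le> norm_Linf (wL Y)"
    unfolding grid_lagr_simps
    by (intro AE_I2 cell_avg_bound[OF d in_L2_cell[OF in_F_parts(6) d] AE_abs_le_norm_Linf[OF w] norm_Linf_nonneg])
  have hZ: "AE \<xi> in lebesgue. \<bar>hL Z \<xi>\<bar> \<le> norm_Linf (hL Y)"
    unfolding grid_lagr_simps
    by (intro AE_I2 cell_avg_bound[OF d in_L2_cell[OF in_F_parts(7) d] AE_abs_le_norm_Linf[OF h] norm_Linf_nonneg])
  have qZm: "qL Z \<in> borel_measurable lebesgue"
    unfolding grid_lagr_simps(7) by (intro borel_measurable_diff borel_measurable_const measurable_grid_lagr)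
  have "AE \<xi>::real in lebesgue. 1 \<le> norm_Linf (qL Y) + norm_Linf (hL Y)"
    using energy AE_abs_le_norm_Linf[OF q] AE_abs_le_norm_Linf[OF h] by eventually_elim linarith
  then have one: "1 \<le> norm_Linf (qL Y) + norm_Linf (hL Y)"
    using ae_filter_eq_bot_iff[of "lebesgue :: real measure"] eventually_const[of "ae_filter (lebesgue :: real measure)"]
    by simp
  have "\<bar>qL Z \<xi>\<bar> \<le> norm_Linf (qL Y) + norm_Linf (hL Y)" for \<xi>
    using hZ_bounds[of \<xi>] one unfolding grid_lagr_simps(7) by linarith
  then have qZ: "AE \<xi> in lebesgue. \<bar>qL Z \<xi>\<bar> \<le> norm_Linf (qL Y) + norm_Linf (hL Y)" by (intro AE_I2)
  have rUm: "(\<lambda>\<xi>. r \<xi> * UL Z \<xi>) \<in> borel_measurable lebesgue"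
    by (intro borel_measurable_times r(1) measurable_grid_lagr)
  have rUae: "AE \<xi> in lebesgue. \<bar>r \<xi> * UL Z \<xi>\<bar> \<le> \<bar>r \<xi> * UL Y \<xi>\<bar>"
    unfolding abs_mult by (intro AE_I2 mult_left_mono UZ_le) simp
  note rUZ = in_L2_bound[OF rUm rU rUae]
  have rwZ: "in_L2 (\<lambda>\<xi>. r \<xi> * wL Z \<xi>)" "norm_L2 (\<lambda>\<xi>. r \<xi> * wL Z \<xi>) \<le> K * norm_L2 (\<lambda>\<xi>. r \<xi> * wL Y \<xi>)"
    unfolding grid_lagr_simps
    by (rule cell_avg_weighted_L2[OF d in_F_parts(6) r(1,2) K r(3) rw]; assumption)+
  have shZ: "integrable lebesgue (\<lambda>\<xi>. s \<xi> * hL Z \<xi>)"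
    "(LINT \<xi>|lebesgue. s \<xi> * hL Z \<xi>) \<le> K * (LINT \<xi>|lebesgue. s \<xi> * hL Y \<xi>)"
    unfolding grid_lagr_simps
    by (rule cell_avg_weighted[OF d in_L2_cell[OF in_F_parts(7) d] h_nonneg s(1,2) K s(3) sh]; assumption)+
  have "norm_L1 (\<lambda>\<xi>. s \<xi> * hL Z \<xi>) = (LINT \<xi>|lebesgue. s \<xi> * hL Z \<xi>)"
    unfolding norm_L1_def using hZ_bounds(1) s(2) by (simp add: abs_mult)
  moreover have "(LINT \<xi>|lebesgue. s \<xi> * hL Y \<xi>) \<le> norm_L1 (\<lambda>\<xi>. s \<xi> * hL Y \<xi>)"
    unfolding norm_L1_def by (intro integral_mono integrable_abs sh) simp
  ultimately have shn: "norm_L1 (\<lambda>\<xi>. s \<xi> * hL Z \<xi>) \<le> K * norm_L1 (\<lambda>\<xi>. s \<xi> * hL Y \<xi>)"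
    using shZ(2) mult_left_mono[OF _ K] by (metis order_trans)
  have mem: "Z \<in> F_weighted r s"
    unfolding F_weighted_def in_L1_def
    using Z_in_F in_LinfI[OF qZm qZ] in_LinfI[OF measurable_grid_lagr(5) wZ] in_LinfI[OF measurable_grid_lagr(6) hZ]
      rUZ(1) rwZ(1) shZ(1) by simp
  let ?F = "norm_F Y" and ?q = "norm_Linf (qL Y)" and ?w = "norm_Linf (wL Y)" and ?h = "norm_Linf (hL Y)"
    and ?a = "norm_L2 (\<lambda>\<xi>. r \<xi> * UL Y \<xi>)" and ?b = "norm_L2 (\<lambda>\<xi>. r \<xi> * wL Y \<xi>)"
    and ?c = "norm_L1 (\<lambda>\<xi>. s \<xi> * hL Y \<xi>)"
  have L2: "0 \<le> norm_L2 f" for f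
    unfolding norm_L2_def by (intro real_sqrt_ge_zero Bochner_Integration.integral_nonneg) simp
  have nn: "0 \<le> ?F" "0 \<le> ?q" "0 \<le> ?w" "0 \<le> ?h" "0 \<le> ?a" "0 \<le> ?b" "0 \<le> ?c"
    unfolding norm_F_def norm_L1_def
    by (intro add_nonneg_nonneg L2 norm_Linf_nonneg Bochner_Integration.integral_nonneg abs_ge_zero)+
  have "norm_F_weighted r s Z \<le> ?F + (?q + ?h) + ?w + ?h + ?a + K * ?b + K * ?c"
    unfolding norm_F_weighted_def
    by (intro add_mono norm_F_Z norm_Linf_le[OF qZm qZ] norm_Linf_le[OF measurable_grid_lagr(5) wZ]
        norm_Linf_le[OF measurable_grid_lagr(6) hZ] rUZ(2) rwZ(2) shn)
  also have "\<dots> = (?F + (?q + ?h) + ?w + ?h + ?a) + (K * ?b + K * ?c)" by (simp only: add.assoc)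
  also have "\<dots> \<le> (?F + ?q + ?w + ?h + ?a + ?b + ?c) + (?F + ?q + ?w + ?h + ?a + ?b + ?c) + K * (?F + ?q + ?w + ?h + ?a + ?b + ?c)"
  proof -
    have K_part: "K * ?b + K * ?c \<le> K * (?F + ?q + ?w + ?h + ?a + ?b + ?c)"
      unfolding distrib_left[symmetric] using nn by (intro mult_left_mono K) linarith
    have "?F + (?q + ?h) + ?w + ?h + ?a \<le> (?F + ?q + ?w + ?h + ?a + ?b + ?c) + (?F + ?q + ?w + ?h + ?a + ?b + ?c)"
      using nn by linarith
    then show ?thesis by (rule add_mono[OF _ K_part])
  qed
  also have "\<dots> = (2 + K) * norm_F_weighted r s Y"
    unfolding norm_F_weighted_def distrib_right mult_2 ..
  finally show ?thesis using mem by blast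
qed

end

end

section \<open>Convergence of the discretization\<close>

lemma norm_Linf_tendsto_0:
  assumes m: "\<And>n. f n \<in> borel_measurable lebesgue"
    and u: "\<And>e. 0 < e \<Longrightarrow> \<forall>\<^sub>F n in sequentially. \<forall>x. \<bar>f n x\<bar> \<le> e"
  shows "(\<lambda>n. norm_Linf (f n)) \<longlonglongrightarrow> 0"
proof (rule tendstoI)
  fix e :: real assume e: "0 < e"
  have "\<forall>\<^sub>F n in sequentially. \<forall>x. \<bar>f n x\<bar> \<le> e / 2" using e by (intro u) simp
  then show "\<forall>\<^sub>F n in sequentially. dist (norm_Linf (f n)) 0 < e"
  proof eventually_elim
    case (elim n)
    have "norm_Linf (f n) \<le> e / 2" by (rule norm_Linf_le[OF m], rule AE_I2) (use elim in blast)
    then show ?case using norm_Linf_nonneg[of "f n"] e by (simp add: dist_real_def)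
  qed
qed

lemma norm_L2_cong_AE:
  assumes "f \<in> borel_measurable lebesgue" "g \<in> borel_measurable lebesgue"
    and "AE x in lebesgue. (f x)\<^sup>2 = (g x)\<^sup>2"
  shows "norm_L2 f = norm_L2 g"
  unfolding norm_L2_def using assms
  by (intro arg_cong[of _ _ sqrt] integral_cong_AE borel_measurable_power)

context normalized_lagr
begin

context
  fixes d :: "nat \<Rightarrow> real" and N :: "nat \<Rightarrow> nat"
  assumes d: "\<And>n. 1 \<le> n \<Longrightarrow> 0 < d n" "\<And>n. 1 \<le> n \<Longrightarrow> d n \<le> 1 / real n"
    and N: "\<And>n. 1 \<le> n \<Longrightarrow> real n \<le> real (N n) * d n"
begin

abbreviation "Zn n \<equiv> grid_lagr (d n) (N n) Y"

lemma eventually_fine: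
  assumes e: "0 < e"
  shows "\<forall>\<^sub>F n in sequentially. 1 \<le> n \<and> d n \<le> e \<and> R \<le> real (N n) * d n"
proof -
  obtain m :: nat where m: "max (1 / e) R < real m" using reals_Archimedean2 by blast
  show ?thesis
  proof (rule eventually_sequentiallyI[of "max m 1"])
    fix n assume n: "max m 1 \<le> n"
    then have n1: "1 \<le> n" and mn: "real m \<le> real n" by simp_all
    have "1 / e < real n" using m mn by linarith
    then have "1 / real n < e" using e n1 by (simp add: field_simps)
    then show "1 \<le> n \<and> d n \<le> e \<and> R \<le> real (N n) * d n"
      using d(2)[OF n1] N[OF n1] n1 m mn by linarith
  qed
qed

text \<open>\<open>H\<close> is 1-Lipschitz, tends to 0 on the left, and is increasing and bounded, hence almost constant far
to the right. The three regions of the line are covered by these three facts.\<close>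

lemma H_uniform:
  assumes e: "0 < e"
  shows "\<forall>\<^sub>F n in sequentially. \<forall>\<xi>. \<bar>HL (Zn n) \<xi> - HL Y \<xi>\<bar> \<le> e"
proof -
  have "\<forall>\<^sub>F x in at_bot. HL Y x < e" by (rule order_tendstoD(2)[OF H_at_bot e])
  then obtain a where a: "\<And>x. x \<le> a \<Longrightarrow> HL Y x < e" by (auto simp: eventually_at_bot_linorder)
  obtain B where B: "\<And>x. HL Y x \<le> B" using H_bounded by blast
  then have bdd: "bdd_above (range (HL Y))" by (intro bdd_aboveI2)
  have "\<exists>y\<in>range (HL Y). (SUP x. HL Y x) - e < y"
    by (subst less_cSup_iff[symmetric]) (use bdd e in auto)
  then obtain b where b: "(SUP x. HL Y x) - e < HL Y b" by blast
  have tail: "HL Y x - HL Y z \<le> e" if "b \<le> z" for x z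
    using b H_mono[OF that] cSUP_upper[OF UNIV_I bdd, of x] by linarith
  have "\<forall>\<^sub>F n in sequentially. 1 \<le> n \<and> d n \<le> e \<and> max (- a) b \<le> real (N n) * d n"
    by (rule eventually_fine[OF e])
  then show ?thesis
  proof eventually_elim
    case (elim n)
    have dn: "0 < d n" using d(1) elim by simp
    show ?case
    proof
      fix \<xi>
      let ?i = "\<lfloor>\<xi> / d n\<rfloor>"
      consider (left) "?i < - int (N n)" | (mid) "- int (N n) \<le> ?i" "?i < int (N n)" | (right) "int (N n) \<le> ?i"
        by linarith
      then show "\<bar>HL (Zn n) \<xi> - HL Y \<xi>\<bar> \<le> e"
      proof cases
        case left
        then have "\<xi> < - (real (N n) * d n)"
          using dn by (simp add: floor_less_iff pos_divide_less_eq)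
        then have "HL Y \<xi> < e" by (intro a) (use elim in linarith)
        then show ?thesis using left H_nonneg[of \<xi>] by (simp add: grid_lagr_simps step_fun_def)
      next
        case mid
        have c: "of_int ?i * d n \<le> \<xi>" "\<xi> - of_int ?i * d n \<le> d n"
          using mem_own_cell[OF dn, of \<xi>] by (auto simp: cell_def algebra_simps)
        have "HL (Zn n) \<xi> = HL Y (of_int ?i * d n)"
          using mid by (simp add: grid_lagr_simps step_fun_def min_def)
        then show ?thesis using H_mono[OF c(1)] H_lipschitz[OF c(1)] c(2) elim by linarith
      next
        case right
        then have R: "real (N n) * d n \<le> \<xi>" using dn by (simp add: le_floor_iff pos_le_divide_eq)
        have "HL (Zn n) \<xi> = HL Y (real (N n) * d n)"
          using right by (simp add: grid_lagr_simps step_fun_def min_def)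
        moreover have "b \<le> real (N n) * d n" using elim by simp
        ultimately show ?thesis using tail[of "real (N n) * d n" \<xi>] H_mono[OF R] by linarith
      qed
    qed
  qed
qed

lemma U_uniform:
  assumes e: "0 < e"
  shows "\<forall>\<^sub>F n in sequentially. \<forall>\<xi>. \<bar>UL (Zn n) \<xi> - UL Y \<xi>\<bar> \<le> e"
proof -
  obtain R where R: "\<And>x. R \<le> \<bar>x\<bar> \<Longrightarrow> \<bar>UL Y x\<bar> < e"
    using lipschitz_L2_vanishes_at_infinity[OF U_lipschitz in_F_parts(3) e] by blast
  have "\<forall>\<^sub>F n in sequentially. 1 \<le> n \<and> d n \<le> e \<and> R \<le> real (N n) * d n"
    by (rule eventually_fine[OF e])
  then show ?thesis
  proof eventually_elim
    case (elim n)
    have dn: "0 < d n" using d(1) elim by simp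
    show ?case
    proof
      fix \<xi>
      let ?i = "\<lfloor>\<xi> / d n\<rfloor>"
      show "\<bar>UL (Zn n) \<xi> - UL Y \<xi>\<bar> \<le> e"
      proof (cases "- (real (N n) * d n) \<le> \<xi> \<and> \<xi> < real (N n) * d n")
        case True
        then have eq: "UL (Zn n) \<xi> = UL Y (min_point (d n) (UL Y) ?i)"
          using window_iff[OF dn, of "N n" \<xi>] by (simp add: grid_lagr_simps step_fun_def window_def)
        have "\<bar>min_point (d n) (UL Y) ?i - \<xi>\<bar> \<le> d n"
          using min_point(1)[OF dn U_continuous, of ?i] cell_subset_Icc[OF dn, of \<xi>]
          by (simp add: algebra_simps abs_le_iff)
        then show ?thesis
          unfolding eq using U_lipschitz[of "min_point (d n) (UL Y) ?i" \<xi>] U_lipschitz[of \<xi> "min_point (d n) (UL Y) ?i"] elim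
          by linarith
      next
        case False
        then have "\<xi> \<in> {..<- (real (N n) * d n)} \<union> {real (N n) * d n..}" by auto
        from window_step_fun_outside[OF dn this] have "UL (Zn n) \<xi> = 0" by (simp add: grid_lagr_simps)
        moreover have "\<bar>UL Y \<xi>\<bar> < e" by (rule R) (use False elim in linarith)
        ultimately show ?thesis by simp
      qed
    qed
  qed
qed

text \<open>Dominated convergence: the convergence is uniform and \<open>\<bar>U\<^sub>n\<bar> \<le> \<bar>U\<bar>\<close>.\<close>

lemma U_L2_tendsto: "(\<lambda>n. norm_L2 (\<lambda>\<xi>. UL (Zn n) \<xi> - UL Y \<xi>)) \<longlonglongrightarrow> 0"
proof -
  have Um: "UL Y \<in> borel_measurable lebesgue" and U2: "integrable lebesgue (\<lambda>\<xi>. (UL Y \<xi>)\<^sup>2)"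
    using in_F_parts(3) by (auto simp: in_L2_def)
  \<comment> \<open>shifted by one because nothing is known about the grid for \<open>n = 0\<close>\<close>
  have "(\<lambda>n. LINT \<xi>|lebesgue. (UL (Zn (Suc n)) \<xi> - UL Y \<xi>)\<^sup>2) \<longlonglongrightarrow> (LINT \<xi>::real|lebesgue. 0)"
  proof (rule integral_dominated_convergence[where w="\<lambda>\<xi>. 4 * (UL Y \<xi>)\<^sup>2"])
    show "(\<lambda>\<xi>. (UL (Zn (Suc n)) \<xi> - UL Y \<xi>)\<^sup>2) \<in> borel_measurable lebesgue" for n
      by (intro borel_measurable_power borel_measurable_diff measurable_grid_lagr Um)
    show "AE \<xi> in lebesgue. (\<lambda>n. (UL (Zn (Suc n)) \<xi> - UL Y \<xi>)\<^sup>2) \<longlonglongrightarrow> 0"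
    proof (rule AE_I2)
      fix \<xi> :: real
      have "(\<lambda>n. UL (Zn n) \<xi> - UL Y \<xi>) \<longlonglongrightarrow> 0"
      proof (rule tendstoI)
        fix e :: real assume e: "0 < e"
        have "\<forall>\<^sub>F n in sequentially. \<forall>\<xi>. \<bar>UL (Zn n) \<xi> - UL Y \<xi>\<bar> \<le> e / 2"
          by (rule U_uniform) (use e in simp)
        then show "\<forall>\<^sub>F n in sequentially. dist (UL (Zn n) \<xi> - UL Y \<xi>) 0 < e"
        proof eventually_elim
          case (elim n)
          then have "\<bar>UL (Zn n) \<xi> - UL Y \<xi>\<bar> \<le> e / 2" by blast
          then show ?case using e by (simp add: dist_real_def)
        qed
      qed
      from tendsto_power[OF LIMSEQ_Suc[OF this], of 2]
      show "(\<lambda>n. (UL (Zn (Suc n)) \<xi> - UL Y \<xi>)\<^sup>2) \<longlonglongrightarrow> 0" by simp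
    qed
    show "AE \<xi> in lebesgue. norm ((UL (Zn (Suc n)) \<xi> - UL Y \<xi>)\<^sup>2) \<le> 4 * (UL Y \<xi>)\<^sup>2" for n
    proof (rule AE_I2)
      fix \<xi> :: real
      have "\<bar>UL (Zn (Suc n)) \<xi> - UL Y \<xi>\<bar> \<le> 2 * \<bar>UL Y \<xi>\<bar>"
        using UZ_le[OF d(1)[of "Suc n"], of "N (Suc n)" \<xi>] by simp
      then have "\<bar>UL (Zn (Suc n)) \<xi> - UL Y \<xi>\<bar>\<^sup>2 \<le> (2 * \<bar>UL Y \<xi>\<bar>)\<^sup>2" by (rule power_mono) simp
      then show "norm ((UL (Zn (Suc n)) \<xi> - UL Y \<xi>)\<^sup>2) \<le> 4 * (UL Y \<xi>)\<^sup>2"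
        by (simp add: power_mult_distrib)
    qed
  qed (use U2 in simp_all)
  then have "(\<lambda>n. LINT \<xi>|lebesgue. (UL (Zn (Suc n)) \<xi> - UL Y \<xi>)\<^sup>2) \<longlonglongrightarrow> 0" by simp
  then have "(\<lambda>n. LINT \<xi>|lebesgue. (UL (Zn n) \<xi> - UL Y \<xi>)\<^sup>2) \<longlonglongrightarrow> 0"
    by (rule LIMSEQ_imp_Suc)
  from tendsto_real_sqrt[OF this] show ?thesis by (simp add: norm_L2_def)
qed

lemma norm_F_tendsto: "(\<lambda>n. norm_F (diffL (Zn n) Y)) \<longlonglongrightarrow> 0"
proof -
  have Ym: "zetaL Y \<in> borel_measurable lebesgue" "UL Y \<in> borel_measurable lebesgue"
    "HL Y \<in> borel_measurable lebesgue" "vL Y \<in> borel_measurable lebesgue" "hL Y \<in> borel_measurable lebesgue"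
    using in_F_parts by (auto simp: in_Linf_def in_L2_def)
  have H: "(\<lambda>n. norm_Linf (\<lambda>\<xi>. HL (Zn n) \<xi> - HL Y \<xi>)) \<longlonglongrightarrow> 0"
    by (rule norm_Linf_tendsto_0[OF _ H_uniform]) (intro borel_measurable_diff measurable_grid_lagr Ym)
  have "\<bar>zetaL (Zn n) \<xi> - zetaL Y \<xi>\<bar> = \<bar>HL (Zn n) \<xi> - HL Y \<xi>\<bar>" for n \<xi>
    unfolding zeta_eq grid_lagr_simps(2) by linarith
  then have zeta: "(\<lambda>n. norm_Linf (\<lambda>\<xi>. zetaL (Zn n) \<xi> - zetaL Y \<xi>)) \<longlonglongrightarrow> 0"
    using H by (simp add: norm_Linf_def)
  have U: "(\<lambda>n. norm_Linf (\<lambda>\<xi>. UL (Zn n) \<xi> - UL Y \<xi>)) \<longlonglongrightarrow> 0"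
    by (rule norm_Linf_tendsto_0[OF _ U_uniform]) (intro borel_measurable_diff measurable_grid_lagr Ym)
  have h: "(\<lambda>n. norm_L2 (\<lambda>\<xi>. hL (Zn n) \<xi> - hL Y \<xi>)) \<longlonglongrightarrow> 0"
    unfolding grid_lagr_simps by (rule cell_avg_tendsto_L2[OF d N in_F_parts(7) h_bound])
  have w: "(\<lambda>n. norm_L2 (\<lambda>\<xi>. wL (Zn n) \<xi> - wL Y \<xi>)) \<longlonglongrightarrow> 0"
    unfolding grid_lagr_simps by (rule cell_avg_tendsto_L2[OF d N in_F_parts(6) w_bound])
  have "norm_L2 (\<lambda>\<xi>. vL (Zn n) \<xi> - vL Y \<xi>) = norm_L2 (\<lambda>\<xi>. hL (Zn n) \<xi> - hL Y \<xi>)" for n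
  proof (rule norm_L2_cong_AE)
    show "AE \<xi> in lebesgue. (vL (Zn n) \<xi> - vL Y \<xi>)\<^sup>2 = (hL (Zn n) \<xi> - hL Y \<xi>)\<^sup>2"
      using v_eq by eventually_elim (simp add: grid_lagr_simps(5) power2_commute)
  qed (intro borel_measurable_diff measurable_grid_lagr Ym)+
  with h have v: "(\<lambda>n. norm_L2 (\<lambda>\<xi>. vL (Zn n) \<xi> - vL Y \<xi>)) \<longlonglongrightarrow> 0" by simp
  have "(\<lambda>n. norm_F (diffL (Zn n) Y)) \<longlonglongrightarrow> 0 + 0 + 0 + 0 + 0 + 0 + 0"
    unfolding norm_F_def diffL_def lagr.sel
    by (intro tendsto_add zeta U_L2_tendsto U H v w h)
  then show ?thesis by simp
qed

end

end

lemma normalized_lagr_of: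
  assumes u: "in_H1 u" and Y: "lagr_of u Y" and G: "Y \<in> G_set"
  shows "normalized_lagr Y"
proof -
  obtain B where *: "\<And>x z. x \<le> z \<Longrightarrow> HL Y x \<le> HL Y z"
    "\<And>x z. x \<le> z \<Longrightarrow> HL Y z - HL Y x \<le> z - x"
    "\<And>x. 0 \<le> HL Y x" "\<And>x. HL Y x \<le> B" "(HL Y \<longlongrightarrow> 0) at_bot"
    "\<And>x. zetaL Y x = - HL Y x"
    by (rule lagr_of_energy[OF u Y]) blast
  show ?thesis
    by unfold_locales
      (use * lagr_of_U_lipschitz[OF u Y G] G_set_lagr_of_qh[OF u Y G] G in \<open>auto simp: G_set_def\<close>)
qed

section \<open>Weights and mesh sizes\<close>

lemma exp_weight_ratio:
  fixes x z c :: real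
  assumes "\<bar>x - z\<bar> \<le> 1" "0 \<le> c" "c \<le> 1"
  shows "exp (c * \<bar>x\<bar>) \<le> exp 1 * exp (c * \<bar>z\<bar>)"
proof -
  have "c * (\<bar>x\<bar> - \<bar>z\<bar>) \<le> c * 1"
    using assms by (intro mult_left_mono) auto
  then have "c * (\<bar>x\<bar> - \<bar>z\<bar>) \<le> 1" using assms(3) by simp
  then show ?thesis by (simp add: exp_add[symmetric] algebra_simps)
qed

lemma powr_weight_ratio:
  fixes x z b c :: real
  assumes "\<bar>x - z\<bar> \<le> 1" "0 \<le> b" "b \<le> c"
  shows "(1 + \<bar>x\<bar>) powr b \<le> 2 powr c * (1 + \<bar>z\<bar>) powr b"
proof -
  have "(1 + \<bar>x\<bar>) powr b \<le> (2 * (1 + \<bar>z\<bar>)) powr b"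
    using assms by (intro powr_mono2) auto
  also have "\<dots> = 2 powr b * (1 + \<bar>z\<bar>) powr b" by (rule powr_mult)
  also have "\<dots> \<le> 2 powr c * (1 + \<bar>z\<bar>) powr b"
    using assms by (intro mult_right_mono powr_mono) auto
  finally show ?thesis .
qed

lemma mesh_bounds:
  fixes d :: real
  assumes n: "1 \<le> n" and d: "0 < d" "0 < N" and eq: "1 / real n = 1 / (real N * d) + d"
  shows "d \<le> 1 / real n" "d \<le> 1" "real n \<le> real N * d"
proof -
  have R: "0 < real N * d" using d by simp
  show dn: "d \<le> 1 / real n" using eq R by simp
  have "1 / real n \<le> 1" using n by simp
  then show "d \<le> 1" using dn by linarith
  have "1 / (real N * d) \<le> 1 / real n" using eq d by simp
  then show "real n \<le> real N * d" using R n by (simp add: field_simps)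
qed

theorem theorem6p3:
  shows "\<exists>(Ce :: real) (Ca :: real \<Rightarrow> real).
    \<forall>(u :: real \<Rightarrow> real) (Y :: lagr) (\<Delta> :: nat \<Rightarrow> real) (N :: nat \<Rightarrow> nat).
      in_H1 u \<and> Y \<in> G_set \<and> lagr_of u Y \<and>
      (\<forall>n\<ge>1. \<Delta> n > 0 \<and> N n > 0 \<and> 1 / real n = 1 / (real (N n) * \<Delta> n) + \<Delta> n)
      \<longrightarrow>
      (\<exists>Yn :: nat \<Rightarrow> lagr.
        (\<forall>n\<ge>1. Yn n \<in> F_grid (\<Delta> n) (real (N n) * \<Delta> n)) \<and>
        ((\<lambda>n. norm_F (diffL (Yn n) Y)) \<longlonglongrightarrow> 0) \<and>
        (\<forall>n\<ge>1. \<forall>\<xi>.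
           qL (Yn n) \<xi> * hL (Yn n) \<xi> \<ge> (UL (Yn n) \<xi>)\<^sup>2 * (qL (Yn n) \<xi>)\<^sup>2 + (wL (Yn n) \<xi>)\<^sup>2 \<and>
           qL (Yn n) \<xi> + hL (Yn n) \<xi> = 1) \<and>
        (Y \<in> F_exp \<longrightarrow>
           (\<forall>n\<ge>1. Yn n \<in> F_exp \<and> norm_F_exp (Yn n) \<le> Ce * norm_F_exp Y)) \<and>
        (\<forall>\<alpha>>1. Y \<in> F_alpha \<alpha> \<longrightarrow>
           (\<forall>n\<ge>1. Yn n \<in> F_alpha \<alpha> \<and> norm_F_alpha \<alpha> (Yn n) \<le> Ca \<alpha> * norm_F_alpha \<alpha> Y)))"
proof (rule exI[of _ "2 + exp 1"], rule exI[of _ "\<lambda>\<alpha>. 2 + 2 powr \<alpha>"], intro allI impI)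
  fix u Y and \<Delta> :: "nat \<Rightarrow> real" and N :: "nat \<Rightarrow> nat"
  assume "in_H1 u \<and> Y \<in> G_set \<and> lagr_of u Y \<and>
      (\<forall>n\<ge>1. \<Delta> n > 0 \<and> N n > 0 \<and> 1 / real n = 1 / (real (N n) * \<Delta> n) + \<Delta> n)"
  then have u: "in_H1 u" and G: "Y \<in> G_set" and Y: "lagr_of u Y"
    and pos: "\<And>n. 1 \<le> n \<Longrightarrow> 0 < \<Delta> n" "\<And>n. 1 \<le> n \<Longrightarrow> 0 < N n"
    and eq: "\<And>n. 1 \<le> n \<Longrightarrow> 1 / real n = 1 / (real (N n) * \<Delta> n) + \<Delta> n"
    by blast+
  have mesh: "\<Delta> n \<le> 1 / real n" "\<Delta> n \<le> 1" "real n \<le> real (N n) * \<Delta> n" if "1 \<le> n" for n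
    by (rule mesh_bounds[OF that pos(1)[OF that] pos(2)[OF that] eq[OF that]])+
  interpret normalized_lagr Y by (rule normalized_lagr_of[OF u Y G])
  let ?Z = "\<lambda>n. grid_lagr (\<Delta> n) (N n) Y"
  have e: "?Z n \<in> F_exp \<and> norm_F_exp (?Z n) \<le> (2 + exp 1) * norm_F_exp Y"
    if "Y \<in> F_exp" "1 \<le> n" for n
    unfolding F_exp_def norm_F_exp_def
  proof (rule Z_weighted[OF pos(1)[OF that(2)] that(1)[unfolded F_exp_def]])
    show "exp (\<bar>x\<bar> / 2) \<le> exp 1 * exp (\<bar>z\<bar> / 2)" if "\<bar>x - z\<bar> \<le> \<Delta> n" for x z
      using exp_weight_ratio[of x z "1 / 2"] that mesh(2)[OF \<open>1 \<le> n\<close>] by simp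
    show "exp \<bar>x\<bar> \<le> exp 1 * exp \<bar>z\<bar>" if "\<bar>x - z\<bar> \<le> \<Delta> n" for x z
      using exp_weight_ratio[of x z 1] that mesh(2)[OF \<open>1 \<le> n\<close>] by simp
  qed (auto intro!: borel_measurable_lebesgue_continuous continuous_intros)
  have a: "?Z n \<in> F_alpha \<alpha> \<and> norm_F_alpha \<alpha> (?Z n) \<le> (2 + 2 powr \<alpha>) * norm_F_alpha \<alpha> Y"
    if "1 < \<alpha>" "Y \<in> F_alpha \<alpha>" "1 \<le> n" for \<alpha> n
    unfolding F_alpha_def norm_F_alpha_def
  proof (rule Z_weighted[OF pos(1)[OF that(3)] that(2)[unfolded F_alpha_def]])
    show "(1 + \<bar>x\<bar>) powr (\<alpha> / 2) \<le> 2 powr \<alpha> * (1 + \<bar>z\<bar>) powr (\<alpha> / 2)" if "\<bar>x - z\<bar> \<le> \<Delta> n" for x z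
      using that \<open>1 < \<alpha>\<close> mesh(2)[OF \<open>1 \<le> n\<close>] by (intro powr_weight_ratio) auto
    show "(1 + \<bar>x\<bar>) powr \<alpha> \<le> 2 powr \<alpha> * (1 + \<bar>z\<bar>) powr \<alpha>" if "\<bar>x - z\<bar> \<le> \<Delta> n" for x z
      using that \<open>1 < \<alpha>\<close> mesh(2)[OF \<open>1 \<le> n\<close>] by (intro powr_weight_ratio) auto
  qed (auto intro!: borel_measurable_lebesgue_continuous continuous_intros)
  have "(\<lambda>n. norm_F (diffL (?Z n) Y)) \<longlonglongrightarrow> 0"
    by (rule norm_F_tendsto) (use pos mesh in blast)+
  moreover have "?Z n \<in> F_grid (\<Delta> n) (real (N n) * \<Delta> n)" if "1 \<le> n" for n
    by (rule Z_in_grid[OF pos(1)[OF that]])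
  moreover have "(UL (?Z n) \<xi>)\<^sup>2 * (qL (?Z n) \<xi>)\<^sup>2 + (wL (?Z n) \<xi>)\<^sup>2 \<le> qL (?Z n) \<xi> * hL (?Z n) \<xi> \<and>
      qL (?Z n) \<xi> + hL (?Z n) \<xi> = 1" if "1 \<le> n" for n \<xi>
    using relation_Z[OF pos(1)[OF that]] by (simp add: grid_lagr_simps(7))
  ultimately show "\<exists>Yn :: nat \<Rightarrow> lagr.
        (\<forall>n\<ge>1. Yn n \<in> F_grid (\<Delta> n) (real (N n) * \<Delta> n)) \<and>
        ((\<lambda>n. norm_F (diffL (Yn n) Y)) \<longlonglongrightarrow> 0) \<and>
        (\<forall>n\<ge>1. \<forall>\<xi>.
           qL (Yn n) \<xi> * hL (Yn n) \<xi> \<ge> (UL (Yn n) \<xi>)\<^sup>2 * (qL (Yn n) \<xi>)\<^sup>2 + (wL (Yn n) \<xi>)\<^sup>2 \<and>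
           qL (Yn n) \<xi> + hL (Yn n) \<xi> = 1) \<and>
        (Y \<in> F_exp \<longrightarrow>
           (\<forall>n\<ge>1. Yn n \<in> F_exp \<and> norm_F_exp (Yn n) \<le> (2 + exp 1) * norm_F_exp Y)) \<and>
        (\<forall>\<alpha>>1. Y \<in> F_alpha \<alpha> \<longrightarrow>
           (\<forall>n\<ge>1. Yn n \<in> F_alpha \<alpha> \<and> norm_F_alpha \<alpha> (Yn n) \<le> (2 + 2 powr \<alpha>) * norm_F_alpha \<alpha> Y))"
    using e a by (intro exI[of _ ?Z]) blast
qed

end
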